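(* Consider the system $x_{k+1}=Ax_k+Bw_k$, $y^i_k=C^ix_k+D^iv^i_k$ ($i\in\mathcal V=\{1,\dots,N\}$) and the DIO (described in the context) run with fixed gains $L^i,\Gamma^i$ and $d\in\mathbb N$ network iterations. The noise-free collective error dynamics $e_{k+1}=H_k\hat A e_k$ (obtained when $\underline w=\overline w=0$, $\underline v^i=\overline v^i=0$) is globally exponentially stable if and only if there exists $H_*\in\mathcal H_d$ such that $H_*\hat A$ is Schur stable (spectral radius $<1$). Consequently, the DIO is input-to-state stable (i.e. a distributed interval observer) if and only if such an $H_*$ exists.
   Context: Entrywise inequalities/max/min; $M^+_{ij}=\max\{M_{ij},0\}$, $M^-=M^+-M$. System data: $x_0\in[\underline x_0,\overline x_0]$, $w_k\in[\underline w,\overline w]$, $v^i_k\in[\underline v^i,\overline v^i]$. $G=(\mathcal V,E)$ directed, $\mathcal N_i=\{j:(i,j)\in E\}\cup\{i\}$, $\mathcal N_i^d$ = nodes reachable from $i$ by a directed path of length $\le d$ (including $i$). DIO: $T^i=I_n-\Gamma^iC^i$, $\tilde A^i=T^iA-L^iC^i$; $\underline x^i_0=\underline x_0$, $\overline x^i_0=\overline x_0$; for each $k$, $\underline x^{i,0}_{k+1}=(\tilde A^i)^+\underline x^i_k-(\tilde A^i)^-\overline x^i_k+(T^iB)^+\underline w-(T^iB)^-\overline w+L^iy^i_k+\Gamma^iy^i_{k+1}-((L^iD^i)^++(\Gamma^iD^i)^+)\overline v^i+((L^iD^i)^-+(\Gamma^iD^i)^-)\underline v^i$, $\overline x^{i,0}_{k+1}=(\tilde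 A^i)^+\overline x^i_k-(\tilde A^i)^-\underline x^i_k+(T^iB)^+\overline w-(T^iB)^-\underline w+L^iy^i_k+\Gamma^iy^i_{k+1}-((L^iD^i)^++(\Gamma^iD^i)^+)\underline v^i+((L^iD^i)^-+(\Gamma^iD^i)^-)\overline v^i$, then $\underline x^i_{k+1}=\max_{j\in\mathcal N_i^d}\underline x^{j,0}_{k+1}$, $\overline x^i_{k+1}=\min_{j\in\mathcal N_i^d}\overline x^{j,0}_{k+1}$. Errors $\underline e^i_k=x_k-\underline x^i_k$, $\overline e^i_k=\overline x^i_k-x_k$, $e_k=[(\underline e^1_k)^\top\ (\overline e^1_k)^\top\cdots(\underline e^N_k)^\top\ (\overline e^N_k)^\top]^\top\in\mathbb R^{2Nn}$. $\hat A=\mathrm{diag}(\hat A^1,\dots,\hat A^N)$ with $\hat A^i=\begin{bmatrix}(\tilde A^i)^+&(\tilde A^i)^-\\(\tilde A^i)^-&(\tilde A^i)^+\end{bmatrix}$. In the noise-free case, $e_{k+1}=H_k\hat A e_k$ where $H_k\in\{0,1\}^{2Nn\times2Nn}$ has row $2n(i-1)+s$ equal to $\mathbf e^\top_{2n(j-1)+s}$ with $j$ the smallest index maximizing $(\underline x^{j,0}_{k+1})_s$ over $\mathcal N_i^d$, and row $2n(i-1)+n+s$ equal to $\mathbf e^\top_{2n(j'-1)+n+s}$ with $j'$ the smallest index minimizing $(\overline x^{j',0}_{k+1})_s$ over $\mathcal N_i^d$. $\mathcal H_d$ is the set of all $H\in\{0,1\}^{2Nn\times2Nn}$ such that for every $i\in\mathcal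 V$, $s\in\{1,\dots,n\}$ there exist $j,j'\in\mathcal N_i^d$ with row $2n(i-1)+s$ of $H$ equal to $\mathbf e^\top_{2n(j-1)+s}$ and row $2n(i-1)+n+s$ equal to $\mathbf e^\top_{2n(j'-1)+n+s}$ (these are exactly the matrices that arise as $H_k$ for some framer values). Global exponential stability: there exist $c>0$, $\lambda\in(0,1)$ with $\|e_k\|\le c\lambda^k\|e_0\|$ for all $k$ and all initial data. Input-to-state stability of the DIO: there exist $\beta\in\mathcal{KL}$ and $\gamma\in\mathcal K_\infty$ such that $\|e_k\|\le\beta(\|e_0\|,k)+\gamma(\max_{0\le l\le k}\|\Delta_l\|)$ for all $k\ge0$ and all admissible realizations, where $\Delta_l=[w_l^\top\ (v^1_l)^\top\cdots(v^N_l)^\top]^\top$.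
   Formalization: In input-to-state stability, the norm of Δ_l also includes the widths of the noise intervals (w̄−w̲ and v̄^i−v̲^i), with β, γ uniform over all noise bounds; with Δ_l=(w_l,v_l) alone the "if" part fails, e.g. for w≡0 inside [−1,1]. *)

theory Defs
  imports Complex_Main "Jordan_Normal_Form.Spectral_Radius"
begin

text \<open>Nodes are indexed 0,...,N-1; state components 0,...,n-1 (0-based indexing
  of the paper's 1-based indices).\<close>

record dsys =
  nx    :: nat
  nN    :: nat
  edges :: "(nat \<times> nat) set"
  iters :: nat
  pw    :: nat
  my    :: "nat \<Rightarrow> nat"
  qv    :: "nat \<Rightarrow> nat"
  sA    :: "real mat"
  sB    :: "real mat"
  sC    :: "nat \<Rightarrow> real mat"
  sD    :: "nat \<Rightarrow> real mat"
  sL    :: "nat \<Rightarrow> real mat"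
  sG    :: "nat \<Rightarrow> real mat"

definition wf_dsys :: "dsys \<Rightarrow> bool" where
  "wf_dsys S \<longleftrightarrow> nx S > 0 \<and> nN S > 0 \<and>
     edges S \<subseteq> {0..<nN S} \<times> {0..<nN S} \<and>
     sA S \<in> carrier_mat (nx S) (nx S) \<and> sB S \<in> carrier_mat (nx S) (pw S) \<and>
     (\<forall>i<nN S. sC S i \<in> carrier_mat (my S i) (nx S) \<and>
               sD S i \<in> carrier_mat (my S i) (qv S i) \<and>
               sL S i \<in> carrier_mat (nx S) (my S i) \<and>
               sG S i \<in> carrier_mat (nx S) (my S i))"

definition posm :: "real mat \<Rightarrow> real mat" where
  "posm M = map_mat (\<lambda>x. max x 0) M"
definition negm :: "real mat \<Rightarrow> real mat" where
  "negm M = posm M - M"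

definition vle :: "real vec \<Rightarrow> real vec \<Rightarrow> bool" where
  "vle u v \<longleftrightarrow> dim_vec u = dim_vec v \<and> (\<forall>i<dim_vec u. u $ i \<le> v $ i)"

definition vnorm :: "real vec \<Rightarrow> real" where
  "vnorm v = sqrt (\<Sum>i<dim_vec v. (v $ i)\<^sup>2)"

definition nbhd :: "dsys \<Rightarrow> nat \<Rightarrow> nat set" where
  "nbhd S i = {j. \<exists>k\<le>iters S. (i, j) \<in> edges S ^^ k}"

definition Tm :: "dsys \<Rightarrow> nat \<Rightarrow> real mat" where
  "Tm S i = 1\<^sub>m (nx S) - sG S i * sC S i"

definition At :: "dsys \<Rightarrow> nat \<Rightarrow> real mat" where
  "At S i = Tm S i * sA S - sL S i * sC S i"

fun traj :: "dsys \<Rightarrow> real vec \<Rightarrow> (nat \<Rightarrow> real vec) \<Rightarrow> nat \<Rightarrow> real vec" where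
  "traj S x0 w 0 = x0"
| "traj S x0 w (Suc k) = sA S *\<^sub>v traj S x0 w k + sB S *\<^sub>v w k"

definition outp :: "dsys \<Rightarrow> real vec \<Rightarrow> (nat \<Rightarrow> real vec) \<Rightarrow> (nat \<Rightarrow> nat \<Rightarrow> real vec)
                    \<Rightarrow> nat \<Rightarrow> nat \<Rightarrow> real vec" where
  "outp S x0 w v k i = sC S i *\<^sub>v traj S x0 w k + sD S i *\<^sub>v v k i"

definition lo0 :: "dsys \<Rightarrow> real vec \<Rightarrow> real vec \<Rightarrow> (nat \<Rightarrow> real vec) \<Rightarrow> (nat \<Rightarrow> real vec)
     \<Rightarrow> (nat \<Rightarrow> nat \<Rightarrow> real vec) \<Rightarrow> nat \<Rightarrow> real vec \<Rightarrow> real vec \<Rightarrow> nat \<Rightarrow> real vec" where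
  "lo0 S wlo whi vlo vhi y k lo hi j =
     posm (At S j) *\<^sub>v lo - negm (At S j) *\<^sub>v hi
     + posm (Tm S j * sB S) *\<^sub>v wlo - negm (Tm S j * sB S) *\<^sub>v whi
     + sL S j *\<^sub>v y k j + sG S j *\<^sub>v y (Suc k) j
     - (posm (sL S j * sD S j) + posm (sG S j * sD S j)) *\<^sub>v vhi j
     + (negm (sL S j * sD S j) + negm (sG S j * sD S j)) *\<^sub>v vlo j"

definition hi0 :: "dsys \<Rightarrow> real vec \<Rightarrow> real vec \<Rightarrow> (nat \<Rightarrow> real vec) \<Rightarrow> (nat \<Rightarrow> real vec)
     \<Rightarrow> (nat \<Rightarrow> nat \<Rightarrow> real vec) \<Rightarrow> nat \<Rightarrow> real vec \<Rightarrow> real vec \<Rightarrow> nat \<Rightarrow> real vec" where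
  "hi0 S wlo whi vlo vhi y k lo hi j =
     posm (At S j) *\<^sub>v hi - negm (At S j) *\<^sub>v lo
     + posm (Tm S j * sB S) *\<^sub>v whi - negm (Tm S j * sB S) *\<^sub>v wlo
     + sL S j *\<^sub>v y k j + sG S j *\<^sub>v y (Suc k) j
     - (posm (sL S j * sD S j) + posm (sG S j * sD S j)) *\<^sub>v vlo j
     + (negm (sL S j * sD S j) + negm (sG S j * sD S j)) *\<^sub>v vhi j"

fun dio :: "dsys \<Rightarrow> real vec \<Rightarrow> real vec \<Rightarrow> (nat \<Rightarrow> real vec) \<Rightarrow> (nat \<Rightarrow> real vec)
     \<Rightarrow> real vec \<Rightarrow> real vec \<Rightarrow> (nat \<Rightarrow> nat \<Rightarrow> real vec) \<Rightarrow> nat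
     \<Rightarrow> (nat \<Rightarrow> real vec) \<times> (nat \<Rightarrow> real vec)" where
  "dio S wlo whi vlo vhi xlo0 xhi0 y 0 = (\<lambda>i. xlo0, \<lambda>i. xhi0)"
| "dio S wlo whi vlo vhi xlo0 xhi0 y (Suc k) =
     (let (lo, hi) = dio S wlo whi vlo vhi xlo0 xhi0 y k in
       (\<lambda>i. vec (nx S) (\<lambda>s. Max ((\<lambda>j. lo0 S wlo whi vlo vhi y k (lo j) (hi j) j $ s) ` nbhd S i)),
        \<lambda>i. vec (nx S) (\<lambda>s. Min ((\<lambda>j. hi0 S wlo whi vlo vhi y k (lo j) (hi j) j $ s) ` nbhd S i))))"

text \<open>Collective error e_k in R^{2Nn}: block i (0-based) is [x_k - lower^i_k; upper^i_k - x_k].\<close>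
definition err :: "dsys \<Rightarrow> real vec \<Rightarrow> real vec \<Rightarrow> (nat \<Rightarrow> real vec) \<Rightarrow> (nat \<Rightarrow> real vec)
     \<Rightarrow> real vec \<Rightarrow> real vec \<Rightarrow> real vec \<Rightarrow> (nat \<Rightarrow> real vec) \<Rightarrow> (nat \<Rightarrow> nat \<Rightarrow> real vec)
     \<Rightarrow> nat \<Rightarrow> real vec" where
  "err S wlo whi vlo vhi xlo0 xhi0 x0 w v k =
     (let n = nx S; x = traj S x0 w k;
          F = dio S wlo whi vlo vhi xlo0 xhi0 (outp S x0 w v) k in
      vec (2 * nN S * n) (\<lambda>r. let i = r div (2 * n); t = r mod (2 * n) in
         if t < n then x $ t - fst F i $ t else snd F i $ (t - n) - x $ (t - n)))"

definition hatA :: "dsys \<Rightarrow> real mat" where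
  "hatA S = (let n = nx S in
     mat (2 * nN S * n) (2 * nN S * n) (\<lambda>(r, c).
       if r div (2 * n) = c div (2 * n) then
         (let i = r div (2 * n); a = r mod (2 * n); b = c mod (2 * n) in
          if a < n \<and> b < n then posm (At S i) $$ (a, b)
          else if a < n then negm (At S i) $$ (a, b - n)
          else if b < n then negm (At S i) $$ (a - n, b)
          else posm (At S i) $$ (a - n, b - n))
       else 0))"

definition Hset :: "dsys \<Rightarrow> real mat set" where
  "Hset S = (let n = nx S; M = 2 * nN S * n in
     {H \<in> carrier_mat M M. (\<forall>r<M. \<forall>c<M. H $$ (r, c) \<in> {0, 1}) \<and>
        (\<forall>i<nN S. \<forall>s<n.
           (\<exists>j\<in>nbhd S i. row H (2 * n * i + s) = unit_vec M (2 * n * j + s)) \<and>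
           (\<exists>j'\<in>nbhd S i. row H (2 * n * i + n + s) = unit_vec M (2 * n * j' + n + s)))})"

definition schur_stable :: "real mat \<Rightarrow> bool" where
  "schur_stable M \<longleftrightarrow> spectral_radius (map_mat complex_of_real M) < 1"

text \<open>Noise-free case: all noise bounds zero (hence w = 0, v = 0).\<close>
definition GES_noise_free :: "dsys \<Rightarrow> bool" where
  "GES_noise_free S \<longleftrightarrow> (\<exists>c>0. \<exists>lam. 0 < lam \<and> lam < 1 \<and>
     (\<forall>x0 xlo0 xhi0 k. dim_vec x0 = nx S \<longrightarrow> vle xlo0 x0 \<longrightarrow> vle x0 xhi0 \<longrightarrow>
        vnorm (err S (0\<^sub>v (pw S)) (0\<^sub>v (pw S)) (\<lambda>i. 0\<^sub>v (qv S i)) (\<lambda>i. 0\<^sub>v (qv S i))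
                  xlo0 xhi0 x0 (\<lambda>k. 0\<^sub>v (pw S)) (\<lambda>k i. 0\<^sub>v (qv S i)) k)
        \<le> c * lam ^ k *
          vnorm (err S (0\<^sub>v (pw S)) (0\<^sub>v (pw S)) (\<lambda>i. 0\<^sub>v (qv S i)) (\<lambda>i. 0\<^sub>v (qv S i))
                  xlo0 xhi0 x0 (\<lambda>k. 0\<^sub>v (pw S)) (\<lambda>k i. 0\<^sub>v (qv S i)) 0)))"

definition class_K :: "(real \<Rightarrow> real) \<Rightarrow> bool" where
  "class_K g \<longleftrightarrow> continuous_on {0..} g \<and> strict_mono_on {0..} g \<and> g 0 = 0"

definition class_Kinf :: "(real \<Rightarrow> real) \<Rightarrow> bool" where
  "class_Kinf g \<longleftrightarrow> class_K g \<and> (\<forall>M. \<exists>r\<ge>0. g r > M)"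

definition class_KL :: "(real \<Rightarrow> nat \<Rightarrow> real) \<Rightarrow> bool" where
  "class_KL b \<longleftrightarrow> (\<forall>k. class_K (\<lambda>r. b r k)) \<and>
     (\<forall>r\<ge>0. antimono (b r) \<and> (b r \<longlonglongrightarrow> 0))"

definition dnorm :: "dsys \<Rightarrow> real vec \<Rightarrow> real vec \<Rightarrow> (nat \<Rightarrow> real vec) \<Rightarrow> (nat \<Rightarrow> real vec)
     \<Rightarrow> (nat \<Rightarrow> real vec) \<Rightarrow> (nat \<Rightarrow> nat \<Rightarrow> real vec) \<Rightarrow> nat \<Rightarrow> real" where
  "dnorm S wlo whi vlo vhi w v l = sqrt ((vnorm (w l))\<^sup>2 + (\<Sum>i<nN S. (vnorm (v l i))\<^sup>2)
      + (vnorm (whi - wlo))\<^sup>2 + (\<Sum>i<nN S. (vnorm (vhi i - vlo i))\<^sup>2))"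

definition ISS :: "dsys \<Rightarrow> bool" where
  "ISS S \<longleftrightarrow> (\<exists>\<beta> \<gamma>. class_KL \<beta> \<and> class_Kinf \<gamma> \<and>
     (\<forall>wlo whi vlo vhi xlo0 xhi0 x0 w v k.
        dim_vec wlo = pw S \<longrightarrow> vle wlo whi \<longrightarrow>
        (\<forall>i<nN S. dim_vec (vlo i) = qv S i \<and> vle (vlo i) (vhi i)) \<longrightarrow>
        dim_vec x0 = nx S \<longrightarrow> vle xlo0 x0 \<longrightarrow> vle x0 xhi0 \<longrightarrow>
        (\<forall>l. vle wlo (w l) \<and> vle (w l) whi) \<longrightarrow>
        (\<forall>l. \<forall>i<nN S. vle (vlo i) (v l i) \<and> vle (v l i) (vhi i)) \<longrightarrow>
        vnorm (err S wlo whi vlo vhi xlo0 xhi0 x0 w v k)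
          \<le> \<beta> (vnorm (err S wlo whi vlo vhi xlo0 xhi0 x0 w v 0)) k
            + \<gamma> (Max ((dnorm S wlo whi vlo vhi w v) ` {0..k}))))"

end

theory Submission
  imports Defs
begin

text \<open>Each component of the next error is a minimum, over the admissible neighbours, of linear
  forms in the current error with nonnegative coefficients, plus a nonnegative noise term bounded
  by the noise level. So \<open>e' \<le> H * hatA * e + noise\<close> for every \<open>H\<close> in \<open>Hset\<close>, and one Schur stable
  product bounds all runs. Conversely, let the noise-free run \<open>F^k(1)\<close> started at the all-ones
  vector tend to zero, where \<open>F\<close> is the minimum map. Perturbing, \<open>b_0 = 1\<close> and
  \<open>b_(l+1) = F(b_l) + eps\<close> stay positive while \<open>b_k \<le> 1/2\<close> for some \<open>k\<close> and small \<open>eps\<close>. Since \<open>F\<close> is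
  monotone and homogeneous, \<open>u = min_(l<k) mu^l b_l\<close> with \<open>mu^k = 2\<close> satisfies \<open>F(u) \<le> u / mu\<close>;
  the rows attaining the minimum in \<open>F(u)\<close> form an \<open>H\<close> with \<open>H * hatA * u \<le> u / mu\<close>, so the
  spectral radius is at most \<open>1 / mu\<close>.\<close>

section \<open>Minima of nonnegative linear forms\<close>

locale min_linear_map =
  fixes M :: nat and a :: "nat \<Rightarrow> nat \<Rightarrow> real" and R :: "nat \<Rightarrow> nat set"
  assumes a_nonneg: "r < M \<Longrightarrow> c < M \<Longrightarrow> 0 \<le> a r c"
    and R_subset: "r < M \<Longrightarrow> R r \<subseteq> {..<M}"
    and R_nonempty: "r < M \<Longrightarrow> R r \<noteq> {}"
begin

definition step :: "(nat \<Rightarrow> real) \<Rightarrow> nat \<Rightarrow> real" where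
  "step x r = Min ((\<lambda>q. \<Sum>c<M. a q c * x c) ` R r)"

text \<open>A crude common bound for all row sums. It serves only as a Lipschitz constant of
  \<open>step\<close> in the maximum norm.\<close>

definition total :: real where
  "total = (\<Sum>q<M. \<Sum>c<M. a q c)"

lemma finite_R: "r < M \<Longrightarrow> finite (R r)"
  using R_subset finite_subset by blast

lemma R_less: "r < M \<Longrightarrow> q \<in> R r \<Longrightarrow> q < M"
  using R_subset by blast

lemma step_attained:
  assumes "r < M"
  obtains q where "q \<in> R r" "step x r = (\<Sum>c<M. a q c * x c)"
proof -
  have "step x r \<in> (\<lambda>q. \<Sum>c<M. a q c * x c) ` R r"
    unfolding step_def using finite_R[OF assms] R_nonempty[OF assms] by (intro Min_in) auto
  then show ?thesis using that by blast
qed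

lemma step_le_row: "r < M \<Longrightarrow> q \<in> R r \<Longrightarrow> step x r \<le> (\<Sum>c<M. a q c * x c)"
  unfolding step_def by (intro Min_le) (auto simp: finite_R)

lemma total_nonneg: "0 \<le> total"
  unfolding total_def by (intro sum_nonneg) (auto simp: a_nonneg)

lemma row_sum_le_total:
  assumes "q < M"
  shows "(\<Sum>c<M. a q c) \<le> total"
  unfolding total_def using assms
  by (intro member_le_sum[where f = "\<lambda>q. \<Sum>c<M. a q c"] sum_nonneg) (auto simp: a_nonneg)

lemma step_nonneg:
  assumes "r < M" "\<And>c. c < M \<Longrightarrow> 0 \<le> x c"
  shows "0 \<le> step x r"
proof -
  obtain q where q: "q \<in> R r" "step x r = (\<Sum>c<M. a q c * x c)"
    using step_attained[OF assms(1)] by blast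
  show ?thesis
    unfolding q(2) using R_less[OF assms(1) q(1)] assms(2)
    by (intro sum_nonneg mult_nonneg_nonneg) (auto simp: a_nonneg)
qed

text \<open>The row attaining the minimum for \<open>y\<close> competes in the minimum for
  \<open>x\<close>, so the estimate reduces to that single row. With \<open>t = 1\<close> it is a
  perturbation bound, with \<open>s = 0\<close> it combines monotonicity and homogeneity.\<close>

lemma step_le_affine:
  assumes r: "r < M" and le: "\<And>c. c < M \<Longrightarrow> x c \<le> t * y c + s" and "0 \<le> s"
  shows "step x r \<le> t * step y r + total * s"
proof -
  obtain q where q: "q \<in> R r" "step y r = (\<Sum>c<M. a q c * y c)"
    using step_attained[OF r] by blast
  have qM: "q < M" using R_less[OF r q(1)] .
  have "step x r \<le> (\<Sum>c<M. a q c * x c)" using step_le_row[OF r q(1)] .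
  also have "\<dots> \<le> (\<Sum>c<M. a q c * (t * y c + s))"
    using qM le by (intro sum_mono mult_left_mono) (auto simp: a_nonneg)
  also have "\<dots> = t * step y r + (\<Sum>c<M. a q c) * s"
    by (simp add: q(2) sum.distrib sum_distrib_left sum_distrib_right algebra_simps)
  also have "\<dots> \<le> t * step y r + total * s"
    using row_sum_le_total[OF qM] assms(3) by (simp add: mult_right_mono)
  finally show ?thesis .
qed

lemma decay_imp_contracting_selection:
  assumes e0: "\<And>r. r < M \<Longrightarrow> e 0 r = 1"
    and eS: "\<And>k r. r < M \<Longrightarrow> e (Suc k) r = step (e k) r"
    and lim: "\<And>r. r < M \<Longrightarrow> (\<lambda>k. e k r) \<longlonglongrightarrow> 0"
  obtains lam h u where "lam < 1"
    "\<And>r. r < M \<Longrightarrow> h r \<in> R r"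
    "\<And>r. r < M \<Longrightarrow> 0 < u r"
    "\<And>r. r < M \<Longrightarrow> (\<Sum>c<M. a (h r) c * u c) \<le> lam * u r"
proof -
  have "\<forall>\<^sub>F k in sequentially. \<forall>r\<in>{..<M}. e k r < 1/4"
    using lim by (intro eventually_ball_finite ballI order_tendstoD(2)) auto
  then obtain k0 where k0: "\<And>k r. k \<ge> k0 \<Longrightarrow> r < M \<Longrightarrow> e k r < 1/4"
    unfolding eventually_sequentially by blast
  \<comment> \<open>A positive index is required: \<open>root k 2\<close> and the minimum over
    \<open>{..<k}\<close> both depend on it.\<close>
  define k where "k = Suc k0"
  have ek: "e k r \<le> 1/4" if "r < M" for r
    using k0[of k r] that by (simp add: k_def)
  \<comment> \<open>\<open>eps * g l\<close> bounds the effect of adding \<open>eps\<close> in each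
    of the first \<open>l\<close> steps: one step multiplies the earlier deviation by at most
    \<open>total\<close> and adds \<open>eps\<close>.\<close>
  define g where "g = rec_nat (0::real) (\<lambda>_ z. total * z + 1)"
  have g0: "g 0 = 0" and gS: "g (Suc l) = total * g l + 1" for l
    by (simp_all add: g_def)
  have g_nonneg: "0 \<le> g l" for l
    by (induction l) (auto simp: g0 gS total_nonneg)
  \<comment> \<open>A positive \<open>eps\<close> keeps every component of \<open>b\<close> positive
    even where the unperturbed run vanishes. Its size gives \<open>b k <= 1/4 + 1/4\<close>.\<close>
  define eps where "eps = 1 / (4 * (g k + 1))"
  have eps: "0 < eps" "eps * g k \<le> 1/4"
    using g_nonneg[of k] by (auto simp: eps_def field_simps)
  define b where "b = rec_nat (\<lambda>_. 1) (\<lambda>_ z r. step z r + eps)"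
  have b0: "b 0 r = 1" and bS: "b (Suc l) r = step (b l) r + eps" for l r
    by (simp_all add: b_def)
  have b_pos: "r < M \<Longrightarrow> 0 < b l r" for l r
  proof (induction l arbitrary: r)
    case (Suc l)
    have "0 \<le> step (b l) r" using Suc by (intro step_nonneg) (auto intro: less_imp_le)
    then show ?case using eps by (simp add: bS)
  qed (simp add: b0)
  have b_le: "r < M \<Longrightarrow> b l r \<le> e l r + eps * g l" for l r
  proof (induction l arbitrary: r)
    case (Suc l)
    have "step (b l) r \<le> 1 * step (e l) r + total * (eps * g l)"
      using Suc eps(1) g_nonneg[of l] by (intro step_le_affine) auto
    then show ?case using Suc.prems by (simp add: bS gS eS algebra_simps)
  qed (simp add: b0 g0 e0)
  have bk: "b k r \<le> 1/2" if "r < M" for r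
    using b_le[OF that, of k] ek[OF that] eps(2) by linarith
  define mu where "mu = root k 2"
  have "k > 0" by (simp add: k_def)
  have mu: "1 < mu" "mu ^ k = 2"
    using \<open>k > 0\<close> by (auto simp: mu_def)
  define u where "u = (\<lambda>r. Min ((\<lambda>l. mu ^ l * b l r) ` {..<k}))"
  have u_le: "u r \<le> mu ^ l * b l r" if "l < k" for l r
    unfolding u_def using that by (intro Min_le) auto
  have u_pos: "0 < u r" if "r < M" for r
    unfolding u_def using \<open>k > 0\<close> mu b_pos[OF that] by (subst Min_gr_iff) auto
  have step_u: "step u r \<le> mu ^ l * b (Suc l) r" if "l < k" "r < M" for l r
  proof -
    have "step u r \<le> mu ^ l * step (b l) r + total * 0"
      using that u_le by (intro step_le_affine) auto
    also have "\<dots> \<le> mu ^ l * b (Suc l) r"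
      using mu eps by (simp add: bS)
    finally show ?thesis .
  qed
  have contr: "mu * step u r \<le> u r" if r: "r < M" for r
  proof -
    \<comment> \<open>For \<open>l > 0\<close> this is \<open>step_u\<close> at the preceding index.
      For \<open>l = 0\<close> the cycle closes through the last index \<open>k0\<close>:
      \<open>mu ^ k * b k <= 2 * (1/2) = 1 = b 0\<close>.\<close>
    have "mu * step u r \<le> mu ^ l * b l r" if l: "l < k" for l
    proof (cases l)
      case 0
      have "mu * step u r \<le> mu * (mu ^ k0 * b k r)"
        using step_u[of k0 r] r mu by (intro mult_left_mono) (auto simp: k_def)
      also have "\<dots> = mu ^ k * b k r" by (simp add: k_def)
      also have "\<dots> \<le> 1" using bk[OF r] mu by simp
      finally show ?thesis by (simp add: 0 b0)
    next
      case (Suc l')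
      have "mu * step u r \<le> mu * (mu ^ l' * b l r)"
        using step_u[of l' r] r l mu by (intro mult_left_mono) (auto simp: Suc)
      then show ?thesis by (simp add: Suc)
    qed
    then show ?thesis
      unfolding u_def using \<open>k > 0\<close> by (subst Min_ge_iff) (auto simp: u_def)
  qed
  define h where "h r = (SOME q. q \<in> R r \<and> step u r = (\<Sum>c<M. a q c * u c))" for r
  have h: "h r \<in> R r \<and> step u r = (\<Sum>c<M. a (h r) c * u c)" if "r < M" for r
    unfolding h_def by (rule someI_ex) (use step_attained[OF that, of u] in blast)
  show ?thesis
  proof
    show "1 / mu < 1" using mu by simp
    show "h r \<in> R r" "0 < u r" if "r < M" for r
      using h u_pos that by auto
    show "(\<Sum>c<M. a (h r) c * u c) \<le> 1 / mu * u r" if "r < M" for r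
      using h[OF that] contr[OF that] mu by (simp add: field_simps)
  qed
qed

end

section \<open>Nonnegative Schur stable matrices\<close>

text \<open>In the weighted norm \<open>max_r |v_r| / u_r\<close> the matrix has operator norm at
  most \<open>lam\<close>. For an eigenvalue of largest modulus, the eigenvector equation is read
  off in a component where this maximum is attained.\<close>

lemma contracting_imp_schur_stable:
  assumes P: "P \<in> carrier_mat m m" and "0 < m"
    and nonneg: "\<And>r c. r < m \<Longrightarrow> c < m \<Longrightarrow> 0 \<le> P $$ (r, c)"
    and u_pos: "\<And>r. r < m \<Longrightarrow> 0 < u r"
    and contr: "\<And>r. r < m \<Longrightarrow> (\<Sum>c<m. P $$ (r, c) * u c) \<le> lam * u r"
    and "lam < 1"
  shows "schur_stable P"
proof -
  let ?Q = "map_mat complex_of_real P"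
  have Q: "?Q \<in> carrier_mat m m" using P by simp
  obtain z v where z: "spectral_radius ?Q = norm z" and ev: "eigenvector ?Q v z"
    using spectral_radius_mem_max(1)[OF Q \<open>0 < m\<close>] by (auto simp: spectrum_def eigenvalue_def)
  have v: "v \<in> carrier_vec m" "v \<noteq> 0\<^sub>v m" and zv: "?Q *\<^sub>v v = z \<cdot>\<^sub>v v"
    using ev P by (auto simp: eigenvector_def)
  define t where "t = Max ((\<lambda>r. norm (v $ r) / u r) ` {..<m})"
  have "t \<in> (\<lambda>r. norm (v $ r) / u r) ` {..<m}"
    unfolding t_def using \<open>0 < m\<close> by (intro Max_in) auto
  then obtain r where r: "r < m" "t = norm (v $ r) / u r" by auto
  have t_ge: "norm (v $ c) / u c \<le> t" if "c < m" for c
    unfolding t_def using that by (intro Max_ge) auto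
  have v_le: "norm (v $ c) \<le> t * u c" if "c < m" for c
    using t_ge[OF that] u_pos[OF that] by (simp add: field_simps)
  obtain c where c: "c < m" "v $ c \<noteq> 0"
    using v by (metis eq_vecI carrier_vecD dim_vec index_zero_vec(1) index_zero_vec(2))
  have "0 < norm (v $ c) / u c" using c u_pos by simp
  then have "0 < t" using t_ge[OF c(1)] by linarith
  have vr: "norm (v $ r) = t * u r" using r u_pos[of r] by simp
  have "norm z * norm (v $ r) = norm ((?Q *\<^sub>v v) $ r)"
    using v r(1) by (simp add: zv norm_mult)
  also have "(?Q *\<^sub>v v) $ r = (\<Sum>c<m. complex_of_real (P $$ (r, c)) * v $ c)"
    using P v r(1) by (simp add: scalar_prod_def atLeast0LessThan)
  also have "norm \<dots> \<le> (\<Sum>c<m. P $$ (r, c) * norm (v $ c))"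
    using nonneg r(1) by (intro order.trans[OF norm_sum] sum_mono) (simp add: norm_mult)
  also have "\<dots> \<le> (\<Sum>c<m. P $$ (r, c) * (t * u c))"
    using nonneg r(1) v_le by (intro sum_mono mult_left_mono) auto
  also have "\<dots> = t * (\<Sum>c<m. P $$ (r, c) * u c)"
    by (simp add: sum_distrib_left algebra_simps)
  also have "\<dots> \<le> t * (lam * u r)"
    using contr[OF r(1)] \<open>0 < t\<close> by simp
  finally have "norm z * (t * u r) \<le> lam * (t * u r)"
    by (simp add: vr algebra_simps)
  then have "norm z \<le> lam"
    using \<open>0 < t\<close> u_pos[OF r(1)] by (simp add: zero_less_mult_iff)
  then show ?thesis
    using z \<open>lam < 1\<close> by (simp add: schur_stable_def)
qed

section \<open>Geometric decay of the powers of a Schur stable matrix\<close>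

lemma pow_mat_smult:
  fixes A :: "'a :: comm_semiring_1 mat"
  assumes "A \<in> carrier_mat m m"
  shows "(a \<cdot>\<^sub>m A) ^\<^sub>m k = a ^ k \<cdot>\<^sub>m (A ^\<^sub>m k)"
proof (induction k)
  case 0
  then show ?case using assms by (intro eq_matI) auto
next
  case (Suc k)
  have Ak: "A ^\<^sub>m k \<in> carrier_mat m m" using assms by simp
  have "(a \<cdot>\<^sub>m A) ^\<^sub>m Suc k = (a ^ k \<cdot>\<^sub>m (A ^\<^sub>m k)) * (a \<cdot>\<^sub>m A)"
    by (simp add: Suc)
  also have "\<dots> = a \<cdot>\<^sub>m (a ^ k \<cdot>\<^sub>m (A ^\<^sub>m k * A))"
    using assms Ak by (simp add: mult_smult_assoc_mat[of _ m m _ m] mult_smult_distrib[of _ m m _ m])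
  also have "\<dots> = a ^ Suc k \<cdot>\<^sub>m (A ^\<^sub>m Suc k)"
    by (intro eq_matI) (auto simp: algebra_simps)
  finally show ?case .
qed

text \<open>A spectral radius below 1 bounds the powers of a matrix through its Jordan normal form.
  Applied to \<open>P / lam\<close>, with \<open>lam\<close> strictly between the spectral radius of
  \<open>P\<close> and 1, boundedness becomes decay like \<open>lam ^ k\<close>.\<close>

lemma schur_stable_imp_power_decay:
  assumes P: "P \<in> carrier_mat m m" and "0 < m" and schur: "schur_stable P"
  obtains c lam where "0 < c" "0 < lam" "lam < 1"
    "\<And>k r q. r < m \<Longrightarrow> q < m \<Longrightarrow> \<bar>(P ^\<^sub>m k) $$ (r, q)\<bar> \<le> c * lam ^ k"
proof -
  let ?Q = "map_mat complex_of_real P"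
  have Q: "?Q \<in> carrier_mat m m" using P by simp
  define rho where "rho = spectral_radius ?Q"
  have "0 \<le> rho" using spectral_radius_mem_max(1)[OF Q \<open>0 < m\<close>] by (auto simp: rho_def)
  have "rho < 1" using schur by (simp add: schur_stable_def rho_def)
  \<comment> \<open>The midpoint is positive even if \<open>rho = 0\<close>, so dividing by
    \<open>lam\<close> is safe.\<close>
  define lam where "lam = (rho + 1) / 2"
  have lam: "0 < lam" "lam < 1" "rho < lam"
    using \<open>0 \<le> rho\<close> \<open>rho < 1\<close> by (auto simp: lam_def)
  let ?W = "complex_of_real (1 / lam) \<cdot>\<^sub>m ?Q"
  have W: "?W \<in> carrier_mat m m" using Q by simp
  obtain z v where z: "spectral_radius ?W = norm z" and ev: "eigenvector ?W v z"
    using spectral_radius_mem_max(1)[OF W \<open>0 < m\<close>] by (auto simp: spectrum_def eigenvalue_def)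
  have v: "v \<in> carrier_vec m" "v \<noteq> 0\<^sub>v m" and zv: "?W *\<^sub>v v = z \<cdot>\<^sub>v v"
    using ev P by (auto simp: eigenvector_def)
  \<comment> \<open>An eigenvalue \<open>z\<close> of the scaled matrix gives the eigenvalue
    \<open>lam * z\<close> of the original one, hence
    \<open>lam * norm z <= rho < lam\<close>.\<close>
  have "?Q *\<^sub>v v = (complex_of_real lam * z) \<cdot>\<^sub>v v"
  proof (rule eq_vecI)
    fix i assume "i < dim_vec ((complex_of_real lam * z) \<cdot>\<^sub>v v)"
    then have i: "i < m" using v by simp
    have "(?W *\<^sub>v v) $ i = (z \<cdot>\<^sub>v v) $ i" by (simp only: zv)
    then have "complex_of_real (1 / lam) * (?Q *\<^sub>v v) $ i = z * v $ i"
      using i v P by (simp add: scalar_prod_def sum_distrib_left algebra_simps)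
    then show "(?Q *\<^sub>v v) $ i = ((complex_of_real lam * z) \<cdot>\<^sub>v v) $ i"
      using i v lam by (simp add: field_simps)
  qed (use P v in auto)
  then have "eigenvalue ?Q (complex_of_real lam * z)"
    using v P by (auto simp: eigenvalue_def eigenvector_def)
  then have "norm (complex_of_real lam * z) \<le> rho"
    unfolding rho_def by (intro spectral_radius_mem_max(2)[OF Q \<open>0 < m\<close>]) (auto simp: spectrum_def)
  then have "lam * norm z < lam * 1" using lam by (simp only: norm_mult norm_of_real)
  then have "spectral_radius ?W < 1" using lam z by (simp only: mult_less_cancel_left_pos)
  then obtain c where c: "\<And>k. norm_bound (?W ^\<^sub>m k) c"
    using spectral_radius_jnf_norm_bound_less_1_upper_triangular[OF W] by blast
  have pow: "?W ^\<^sub>m k = complex_of_real (1 / lam) ^ k \<cdot>\<^sub>m map_mat complex_of_real (P ^\<^sub>m k)" for k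
    using pow_mat_smult[OF Q] of_real_hom.mat_hom_pow[OF P] by metis
  show ?thesis
  proof
    \<comment> \<open>Taking \<open>max c 1\<close> makes the constant positive without inspecting
      \<open>c\<close>.\<close>
    show "0 < max c 1" by simp
    show "0 < lam" "lam < 1" using lam by auto
    fix k r q assume rq: "r < m" "q < m"
    have "norm ((?W ^\<^sub>m k) $$ (r, q)) \<le> c"
      using c[of k] rq pow_carrier_mat[OF W, of k] unfolding norm_bound_def by (metis carrier_matD)
    then have "(1 / lam) ^ k * \<bar>(P ^\<^sub>m k) $$ (r, q)\<bar> \<le> c"
      unfolding pow using rq P lam by (simp add: norm_mult norm_power norm_divide)
    then have "\<bar>(P ^\<^sub>m k) $$ (r, q)\<bar> \<le> c * lam ^ k"
      using lam by (simp add: field_simps power_divide)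
    also have "\<dots> \<le> max c 1 * lam ^ k"
      using lam by (intro mult_right_mono) auto
    finally show "\<bar>(P ^\<^sub>m k) $$ (r, q)\<bar> \<le> max c 1 * lam ^ k" .
  qed
qed

section \<open>Comparison with nonnegative linear recurrences\<close>

lemma pow_mat_nonneg:
  assumes P: "P \<in> carrier_mat m m"
    and nonneg: "\<And>r c. r < m \<Longrightarrow> c < m \<Longrightarrow> 0 \<le> (P $$ (r, c) :: real)"
  shows "r < m \<Longrightarrow> c < m \<Longrightarrow> 0 \<le> (P ^\<^sub>m k) $$ (r, c)"
proof (induction k arbitrary: r c)
  case 0
  then show ?case using P by simp
next
  case (Suc k)
  then show ?case using P nonneg
    by (auto simp: scalar_prod_def intro!: sum_nonneg)
qed

lemma pow_mat_Suc_index: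
  assumes "P \<in> carrier_mat m m" "r < m" "c < m"
  shows "(P ^\<^sub>m Suc k) $$ (r, c) = (\<Sum>q<m. (P ^\<^sub>m k) $$ (r, q) * P $$ (q, c))"
  using assms by (simp add: scalar_prod_def atLeast0LessThan)

text \<open>Nonnegative powers of \<open>P\<close> preserve the inequality while the recurrence is
  unrolled. The induction hypothesis is applied to the sequence shifted by one, so the new factor
  \<open>P\<close> lands on the right, as in the recursion of the matrix power.\<close>

lemma linear_comparison:
  fixes e :: "nat \<Rightarrow> nat \<Rightarrow> real"
  assumes P: "P \<in> carrier_mat m m"
    and nonneg: "\<And>r c. r < m \<Longrightarrow> c < m \<Longrightarrow> 0 \<le> P $$ (r, c)"
    and "r < m"
    and "\<And>k r. r < m \<Longrightarrow> e (Suc k) r \<le> (\<Sum>c<m. P $$ (r, c) * e k c) + eta"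
  shows "e k r \<le> (\<Sum>c<m. (P ^\<^sub>m k) $$ (r, c) * e 0 c) + eta * (\<Sum>l<k. \<Sum>c<m. (P ^\<^sub>m l) $$ (r, c))"
  using assms(3,4)
proof (induction k arbitrary: e)
  case 0
  have "(\<Sum>c<m. (P ^\<^sub>m 0) $$ (r, c) * e 0 c) = (\<Sum>c<m. if r = c then e 0 c else 0)"
    using P 0(1) by (intro sum.cong) auto
  then show ?case using 0(1) by simp
next
  case (Suc k)
  have "e (Suc k) r \<le> (\<Sum>q<m. (P ^\<^sub>m k) $$ (r, q) * e 1 q)
      + eta * (\<Sum>l<k. \<Sum>c<m. (P ^\<^sub>m l) $$ (r, c))"
    using Suc.IH[of "\<lambda>k. e (Suc k)"] Suc.prems by simp
  also have "(\<Sum>q<m. (P ^\<^sub>m k) $$ (r, q) * e 1 q)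
      \<le> (\<Sum>q<m. (P ^\<^sub>m k) $$ (r, q) * ((\<Sum>c<m. P $$ (q, c) * e 0 c) + eta))"
    using Suc.prems(2)[of _ 0] pow_mat_nonneg[OF P nonneg] Suc.prems(1)
    by (intro sum_mono mult_left_mono) auto
  also have "\<dots> = (\<Sum>q<m. \<Sum>c<m. (P ^\<^sub>m k) $$ (r, q) * P $$ (q, c) * e 0 c)
      + eta * (\<Sum>q<m. (P ^\<^sub>m k) $$ (r, q))"
    by (simp add: sum.distrib sum_distrib_left algebra_simps)
  also have "(\<Sum>q<m. \<Sum>c<m. (P ^\<^sub>m k) $$ (r, q) * P $$ (q, c) * e 0 c)
      = (\<Sum>c<m. (P ^\<^sub>m Suc k) $$ (r, c) * e 0 c)"
    using P Suc.prems(1)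
    by (subst sum.swap) (simp add: pow_mat_Suc_index sum_distrib_right del: pow_mat.simps)
  finally show ?case by (simp add: algebra_simps del: pow_mat.simps)
qed

text \<open>The constants are obtained before \<open>e\<close>, \<open>eta\<close> and
  \<open>delta\<close>: they depend on \<open>P\<close> alone, which makes the final estimate
  uniform over all runs.\<close>

lemma schur_stable_imp_decay:
  assumes P: "P \<in> carrier_mat m m" and "0 < m" and "schur_stable P"
    and nonneg: "\<And>r c. r < m \<Longrightarrow> c < m \<Longrightarrow> 0 \<le> P $$ (r, c)"
  obtains C lam where "0 < C" "0 < lam" "lam < 1"
    "\<And>e eta delta k r.
      (\<And>k r. r < m \<Longrightarrow> e (Suc k) r \<le> (\<Sum>c<m. P $$ (r, c) * e k c) + eta) \<Longrightarrow> 0 \<le> eta \<Longrightarrow>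
      (\<And>c. c < m \<Longrightarrow> 0 \<le> e 0 c \<and> e 0 c \<le> delta) \<Longrightarrow> r < m \<Longrightarrow>
      e k r \<le> C * lam ^ k * delta + C * eta"
proof -
  obtain b lam where b: "0 < b" "0 < lam" "lam < 1"
    and pow: "\<And>k r q. r < m \<Longrightarrow> q < m \<Longrightarrow> \<bar>(P ^\<^sub>m k) $$ (r, q)\<bar> \<le> b * lam ^ k"
    using schur_stable_imp_power_decay[OF assms(1-3)] by blast
  \<comment> \<open>The factor \<open>real m * b\<close> bounds a row sum of a power, and
    \<open>1 / (1 - lam)\<close> sums the geometric series of accumulated disturbances. The result
    also exceeds \<open>real m * b\<close>, so it serves for both terms.\<close>
  define C where "C = real m * b / (1 - lam)"
  have "real m * b * (1 - lam) \<le> real m * b * 1" using b by (intro mult_left_mono) auto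
  then have Cb: "real m * b \<le> C" using b by (simp add: C_def field_simps)
  have mb: "0 < real m * b" using b \<open>0 < m\<close> by simp
  show ?thesis
  proof
    show "0 < C" using Cb mb by linarith
    show "0 < lam" "lam < 1" using b by auto
    fix e :: "nat \<Rightarrow> nat \<Rightarrow> real" and eta delta :: real and k r :: nat
    assume step: "\<And>k r. r < m \<Longrightarrow> e (Suc k) r \<le> (\<Sum>c<m. P $$ (r, c) * e k c) + eta"
      and eta: "0 \<le> eta" and e0: "\<And>c. c < m \<Longrightarrow> 0 \<le> e 0 c \<and> e 0 c \<le> delta" and r: "r < m"
    have "0 \<le> delta" using e0[OF r] by linarith
    have "(\<Sum>c<m. (P ^\<^sub>m k) $$ (r, c) * e 0 c) \<le> (\<Sum>c<m. b * lam ^ k * delta)"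
      using pow[OF r] e0 b by (intro sum_mono mult_mono) (auto simp: abs_le_iff)
    also have "\<dots> = real m * b * (lam ^ k * delta)" by simp
    also have "\<dots> \<le> C * (lam ^ k * delta)"
      using Cb b \<open>0 \<le> delta\<close> by (intro mult_right_mono) auto
    finally have 1: "(\<Sum>c<m. (P ^\<^sub>m k) $$ (r, c) * e 0 c) \<le> C * lam ^ k * delta" by simp
    have "(\<Sum>l<k. \<Sum>c<m. (P ^\<^sub>m l) $$ (r, c)) \<le> (\<Sum>l<k. \<Sum>c<m. b * lam ^ l)"
      using pow[OF r] by (intro sum_mono) (auto simp: abs_le_iff)
    also have "\<dots> = real m * b * (\<Sum>l<k. lam ^ l)" by (simp add: sum_distrib_left mult.assoc)
    also have "(\<Sum>l<k. lam ^ l) = (1 - lam ^ k) / (1 - lam)"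
      using b by (simp add: sum_gp_strict)
    also have "real m * b * ((1 - lam ^ k) / (1 - lam)) \<le> C"
      unfolding C_def times_divide_eq_right using b mb
      by (intro divide_right_mono mult_left_le) auto
    finally have "(\<Sum>l<k. \<Sum>c<m. (P ^\<^sub>m l) $$ (r, c)) \<le> C" .
    from mult_left_mono[OF this eta]
    have 2: "eta * (\<Sum>l<k. \<Sum>c<m. (P ^\<^sub>m l) $$ (r, c)) \<le> C * eta"
      by (simp only: mult.commute[of C])
    show "e k r \<le> C * lam ^ k * delta + C * eta"
      using linear_comparison[where e = e, OF P nonneg r step, of k] 1 2 by linarith
  qed
qed

section \<open>Structure of the error matrix\<close>

text \<open>The distance between a product \<open>G x\<close> and its interval bound, when
  \<open>f\<close> and \<open>g\<close> are the distances of \<open>x\<close> from the two ends of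
  its interval. The sign of each entry of \<open>G\<close> decides which end counts.\<close>

definition gap :: "real mat \<Rightarrow> (nat \<Rightarrow> real) \<Rightarrow> (nat \<Rightarrow> real) \<Rightarrow> nat \<Rightarrow> real" where
  "gap G f g s = (\<Sum>c<dim_col G. posm G $$ (s, c) * f c) + (\<Sum>c<dim_col G. negm G $$ (s, c) * g c)"

definition row_abs_sum :: "real mat \<Rightarrow> nat \<Rightarrow> real" where
  "row_abs_sum G s = (\<Sum>c<dim_col G. \<bar>G $$ (s, c)\<bar>)"

lemma posm_carrier [simp]: "G \<in> carrier_mat n m \<Longrightarrow> posm G \<in> carrier_mat n m"
  by (simp add: posm_def)

lemma negm_carrier [simp]: "G \<in> carrier_mat n m \<Longrightarrow> negm G \<in> carrier_mat n m"
  by (simp add: negm_def minus_carrier_mat)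

lemma posm_dim [simp]: "dim_row (posm G) = dim_row G" "dim_col (posm G) = dim_col G"
  by (simp_all add: posm_def)

lemma negm_dim [simp]: "dim_row (negm G) = dim_row G" "dim_col (negm G) = dim_col G"
  by (simp_all add: negm_def)

lemma posm_index:
  "s < dim_row G \<Longrightarrow> c < dim_col G \<Longrightarrow> posm G $$ (s, c) = max (G $$ (s, c)) 0"
  by (simp add: posm_def)

lemma negm_index:
  "s < dim_row G \<Longrightarrow> c < dim_col G \<Longrightarrow> negm G $$ (s, c) = max (G $$ (s, c)) 0 - G $$ (s, c)"
  by (simp add: negm_def posm_def)

lemma mult_mat_vec_index:
  "s < dim_row G \<Longrightarrow> dim_vec x = dim_col G \<Longrightarrow> (G *\<^sub>v x) $ s = (\<Sum>c<dim_col G. G $$ (s, c) * x $ c)"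
  by (simp add: scalar_prod_def atLeast0LessThan)

text \<open>Since \<open>G = posm G - negm G\<close>, the lower bound of \<open>G x\<close> takes
  \<open>lo\<close> at positive entries and \<open>hi\<close> at negative ones. For the upper bound
  in \<open>gap_upper\<close> the two distances trade places.\<close>

lemma gap_lower:
  fixes G :: "real mat"
  assumes "s < dim_row G" "dim_vec x = dim_col G" "dim_vec lo = dim_col G" "dim_vec hi = dim_col G"
  shows "(G *\<^sub>v x) $ s - (posm G *\<^sub>v lo) $ s + (negm G *\<^sub>v hi) $ s
    = gap G (\<lambda>c. x $ c - lo $ c) (\<lambda>c. hi $ c - x $ c) s"
  using assms
  by (simp add: mult_mat_vec_index gap_def posm_index negm_index sum.distrib sum_subtractf algebra_simps
      cong: sum.cong_simp del: index_mult_mat_vec)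

lemma gap_upper:
  fixes G :: "real mat"
  assumes "s < dim_row G" "dim_vec x = dim_col G" "dim_vec lo = dim_col G" "dim_vec hi = dim_col G"
  shows "(posm G *\<^sub>v hi) $ s - (negm G *\<^sub>v lo) $ s - (G *\<^sub>v x) $ s
    = gap G (\<lambda>c. hi $ c - x $ c) (\<lambda>c. x $ c - lo $ c) s"
  using assms
  by (simp add: mult_mat_vec_index gap_def posm_index negm_index sum.distrib sum_subtractf algebra_simps
      cong: sum.cong_simp del: index_mult_mat_vec)

lemma gap_nonneg:
  assumes "s < dim_row G" "\<And>c. c < dim_col G \<Longrightarrow> 0 \<le> f c" "\<And>c. c < dim_col G \<Longrightarrow> 0 \<le> g c"
  shows "0 \<le> gap G f g s"
  unfolding gap_def using assms
  by (intro add_nonneg_nonneg sum_nonneg mult_nonneg_nonneg) (auto simp: posm_index negm_index)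

lemma gap_le:
  assumes "s < dim_row G" "\<And>c. c < dim_col G \<Longrightarrow> f c \<le> d" "\<And>c. c < dim_col G \<Longrightarrow> g c \<le> d"
  shows "gap G f g s \<le> row_abs_sum G s * d"
proof -
  have "gap G f g s
      \<le> (\<Sum>c<dim_col G. posm G $$ (s, c) * d) + (\<Sum>c<dim_col G. negm G $$ (s, c) * d)"
    unfolding gap_def using assms
    by (intro add_mono sum_mono mult_left_mono) (auto simp: posm_index negm_index)
  also have "\<dots> = (\<Sum>c<dim_col G. (posm G $$ (s, c) + negm G $$ (s, c)) * d)"
    by (simp add: sum.distrib algebra_simps)
  also have "\<dots> = row_abs_sum G s * d"
    unfolding row_abs_sum_def sum_distrib_right using assms(1)
    by (intro sum.cong) (auto simp: posm_index negm_index abs_if)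
  finally show ?thesis .
qed

lemma row_abs_sum_nonneg: "0 \<le> row_abs_sum G s"
  by (simp add: row_abs_sum_def sum_nonneg)

section \<open>The Euclidean norm compared with single components\<close>

lemma vnorm_nonneg: "0 \<le> vnorm v"
  by (simp add: vnorm_def sum_nonneg)

lemma component_le_vnorm:
  assumes "c < dim_vec v"
  shows "\<bar>v $ c\<bar> \<le> vnorm v"
proof -
  have "(v $ c)\<^sup>2 \<le> (\<Sum>i<dim_vec v. (v $ i)\<^sup>2)"
    using assms by (intro member_le_sum[where f = "\<lambda>i. (v $ i)\<^sup>2"]) auto
  then show ?thesis
    unfolding vnorm_def by (metis real_sqrt_abs real_sqrt_le_mono)
qed

lemma vnorm_le:
  assumes "\<And>c. c < dim_vec v \<Longrightarrow> \<bar>v $ c\<bar> \<le> b"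
  shows "vnorm v \<le> real (dim_vec v) * b"
proof (cases "dim_vec v = 0")
  case True
  then show ?thesis by (simp add: vnorm_def)
next
  case False
  have "0 \<le> b" using assms[of 0] False by linarith
  have "(\<Sum>i<dim_vec v. (v $ i)\<^sup>2) \<le> (\<Sum>i<dim_vec v. b\<^sup>2)"
    using assms by (intro sum_mono abs_le_square_iff[THEN iffD1]) (use \<open>0 \<le> b\<close> in auto)
  also have "\<dots> = real (dim_vec v) * b\<^sup>2" by simp
  \<comment> \<open>Squaring the dimension gives up the sharp factor, its square root, for a
    constant without roots.\<close>
  also have "\<dots> \<le> (real (dim_vec v))\<^sup>2 * b\<^sup>2"
    using False by (intro mult_right_mono self_le_power) (auto simp: Suc_le_eq)
  finally show ?thesis
    unfolding vnorm_def using \<open>0 \<le> b\<close> by (intro real_le_lsqrt) (auto simp: power_mult_distrib)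
qed

section \<open>Block indices of the collective error and the rows of \<open>hatA\<close>\<close>

locale wf_system =
  fixes S :: dsys
  assumes wf: "wf_dsys S"
begin

abbreviation n where "n \<equiv> nx S"
abbreviation N where "N \<equiv> nN S"
abbreviation M where "M \<equiv> 2 * nN S * nx S"

text \<open>Rows of \<open>hatA\<close> that a matrix in \<open>Hset\<close> may put into row \<open>r\<close>.\<close>
definition R :: "nat \<Rightarrow> nat set" where
  "R r = (\<lambda>j. 2 * n * j + r mod (2 * n)) ` nbhd S (r div (2 * n))"

lemma n_pos: "0 < n" and N_pos: "0 < N"
  using wf by (auto simp: wf_dsys_def)

lemma M_pos: "0 < M"
  using n_pos N_pos by simp

lemma carriers:
  "sA S \<in> carrier_mat n n" "sB S \<in> carrier_mat n (pw S)"
  "i < N \<Longrightarrow> sC S i \<in> carrier_mat (my S i) n"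
  "i < N \<Longrightarrow> sD S i \<in> carrier_mat (my S i) (qv S i)"
  "i < N \<Longrightarrow> sL S i \<in> carrier_mat n (my S i)"
  "i < N \<Longrightarrow> sG S i \<in> carrier_mat n (my S i)"
  using wf by (auto simp: wf_dsys_def)

lemma product_carriers:
  assumes "i < N"
  shows "sG S i * sC S i \<in> carrier_mat n n" "sL S i * sC S i \<in> carrier_mat n n"
    "sG S i * sD S i \<in> carrier_mat n (qv S i)" "sL S i * sD S i \<in> carrier_mat n (qv S i)"
  using assms mult_carrier_mat[OF carriers(6) carriers(3)] mult_carrier_mat[OF carriers(5) carriers(3)]
    mult_carrier_mat[OF carriers(6) carriers(4)] mult_carrier_mat[OF carriers(5) carriers(4)]
  by blast+

lemma Tm_carrier: "i < N \<Longrightarrow> Tm S i \<in> carrier_mat n n"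
  unfolding Tm_def by (intro minus_carrier_mat product_carriers)

lemma At_carrier: "i < N \<Longrightarrow> At S i \<in> carrier_mat n n"
  unfolding At_def by (intro minus_carrier_mat product_carriers)

lemma TB_carrier: "i < N \<Longrightarrow> Tm S i * sB S \<in> carrier_mat n (pw S)"
  using mult_carrier_mat[OF Tm_carrier carriers(2)] .

lemma block_index_less:
  assumes "j < N" "t < 2 * n"
  shows "2 * n * j + t < M"
proof -
  have "2 * n * j + t < 2 * n * (j + 1)" using assms(2) by simp
  also have "\<dots> \<le> 2 * n * N" using assms(1) by (intro mult_le_mono2) simp
  finally show ?thesis by (simp add: algebra_simps)
qed

lemma block_less: "r < M \<Longrightarrow> r div (2 * n) < N"
  by (rule less_mult_imp_div_less) (simp only: mult.left_commute mult.assoc)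

lemma pos_less: "r mod (2 * n) < 2 * n"
  using n_pos by simp

lemma block_div_mod:
  assumes "t < 2 * n"
  shows "(2 * n * j + t) div (2 * n) = j" "(2 * n * j + t) mod (2 * n) = t"
  using assms n_pos by simp_all

lemma nbhd_less:
  assumes "i < N" "j \<in> nbhd S i"
  shows "j < N"
proof -
  obtain k where "(i, j) \<in> edges S ^^ k" using assms(2) by (auto simp: nbhd_def)
  moreover have "edges S \<subseteq> {0..<N} \<times> {0..<N}" using wf by (simp add: wf_dsys_def)
  ultimately show ?thesis using assms(1) by (cases k) (auto elim!: relpow_Suc_E)
qed

lemma nbhd_self: "i \<in> nbhd S i"
  unfolding nbhd_def mem_Collect_eq by (rule exI[of _ 0]) simp

lemma finite_nbhd: "i < N \<Longrightarrow> finite (nbhd S i)"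
  by (rule finite_subset[of _ "{..<N}"]) (use nbhd_less[of i] in blast, simp)

lemma hatA_index:
  assumes "r < M" "c < M"
  shows "hatA S $$ (r, c) = (if r div (2 * n) = c div (2 * n) then
         (let i = r div (2 * n); a = r mod (2 * n); b = c mod (2 * n) in
          if a < n \<and> b < n then posm (At S i) $$ (a, b)
          else if a < n then negm (At S i) $$ (a, b - n)
          else if b < n then negm (At S i) $$ (a - n, b)
          else posm (At S i) $$ (a - n, b - n))
       else 0)"
  using assms by (simp add: hatA_def Let_def)

lemma hatA_carrier: "hatA S \<in> carrier_mat M M"
  by (simp add: hatA_def Let_def)

lemma hatA_nonneg:
  assumes "r < M" "c < M"
  shows "0 \<le> hatA S $$ (r, c)"
proof -
  have nonneg: "0 \<le> posm (At S (r div (2 * n))) $$ (s, b)" "0 \<le> negm (At S (r div (2 * n))) $$ (s, b)"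
    if "s < n" "b < n" for s b
    using At_carrier[OF block_less[OF assms(1)]] that by (auto simp: posm_index negm_index)
  \<comment> \<open>In the lower half the truncated subtraction yields 0, which is below
    \<open>n\<close> because \<open>n\<close> is positive.\<close>
  have lt: "r mod (2 * n) - n < n" "c mod (2 * n) - n < n"
    using pos_less[of r] pos_less[of c] n_pos by linarith+
  have if_nonneg: "0 \<le> (if Q then y else 0)" if "0 \<le> y" for Q and y :: real
    using that by simp
  show ?thesis
    unfolding hatA_index[OF assms] Let_def
    by (cases "r mod (2 * n) < n"; cases "c mod (2 * n) < n"; rule if_nonneg) (simp_all add: nonneg lt)
qed

text \<open>In this instance \<open>step\<close> is the noise-free error map: the network step is
  encoded by the rows \<open>R r\<close> that compete in component \<open>r\<close>.\<close>

sublocale min_linear_map M "\<lambda>r c. hatA S $$ (r, c)" R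
proof
  show "0 \<le> hatA S $$ (r, c)" if "r < M" "c < M" for r c using hatA_nonneg that .
  show "R r \<subseteq> {..<M}" if "r < M" for r
    unfolding R_def using nbhd_less[OF block_less[OF that]] block_index_less[OF _ pos_less] by auto
  show "R r \<noteq> {}" for r unfolding R_def using nbhd_self by blast
qed

text \<open>Meant for rows of the block diagonal \<open>hatA\<close>: such a row lives in one block,
  which splits into a half of lower errors and a half of upper errors.\<close>

lemma sum_block:
  fixes f :: "nat \<Rightarrow> real"
  assumes "j < N" and "\<And>c. c < M \<Longrightarrow> c div (2 * n) \<noteq> j \<Longrightarrow> f c = 0"
  shows "(\<Sum>c<M. f c) = (\<Sum>b<n. f (2 * n * j + b)) + (\<Sum>b<n. f (2 * n * j + (n + b)))"
proof -
  have split: "(\<Sum>b<n + m. g b) = (\<Sum>b<n. g b) + (\<Sum>b<m. g (n + b))" for g :: "nat \<Rightarrow> real" and m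
    by (induction m) (auto simp: algebra_simps)
  have "(\<Sum>c<M. f c) = (\<Sum>c\<in>{2 * n * j..<2 * n * j + 2 * n}. f c)"
  proof (rule sum.mono_neutral_right)
    show "{2 * n * j..<2 * n * j + 2 * n} \<subseteq> {..<M}"
    proof
      fix c assume "c \<in> {2 * n * j..<2 * n * j + 2 * n}"
      then show "c \<in> {..<M}" using block_index_less[OF assms(1), of "c - 2 * n * j"] by auto
    qed
    show "\<forall>c\<in>{..<M} - {2 * n * j..<2 * n * j + 2 * n}. f c = 0"
    proof
      fix c assume c: "c \<in> {..<M} - {2 * n * j..<2 * n * j + 2 * n}"
      have "c div (2 * n) \<noteq> j"
      proof
        assume "c div (2 * n) = j"
        then have "c = 2 * n * j + c mod (2 * n)" by auto
        then show False using c pos_less[of c] by auto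
      qed
      then show "f c = 0" using assms(2) c by auto
    qed
  qed simp
  also have "\<dots> = (\<Sum>b<2 * n. f (2 * n * j + b))"
    by (simp add: sum.atLeastLessThan_shift_0 atLeast0LessThan algebra_simps)
  also have "{..<2 * n} = {..<n + n}" by (simp add: mult_2)
  also have "(\<Sum>b<n + n. f (2 * n * j + b))
      = (\<Sum>b<n. f (2 * n * j + b)) + (\<Sum>b<n. f (2 * n * j + (n + b)))"
    by (rule split)
  finally show ?thesis .
qed

text \<open>Brings a row of \<open>hatA\<close> into the form in which the framer errors arise from
  interval bounds, so that the two can be matched term by term.\<close>

lemma hatA_row_lower:
  assumes "j < N" "s < n"
  shows "(\<Sum>c<M. hatA S $$ (2 * n * j + s, c) * e c)
    = gap (At S j) (\<lambda>b. e (2 * n * j + b)) (\<lambda>b. e (2 * n * j + (n + b))) s"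
proof -
  have "(\<Sum>c<M. hatA S $$ (2 * n * j + s, c) * e c)
      = (\<Sum>b<n. hatA S $$ (2 * n * j + s, 2 * n * j + b) * e (2 * n * j + b))
      + (\<Sum>b<n. hatA S $$ (2 * n * j + s, 2 * n * j + (n + b)) * e (2 * n * j + (n + b)))"
    using assms block_index_less[of j s]
    by (intro sum_block) (auto simp: hatA_index block_div_mod)
  also have "\<dots> = gap (At S j) (\<lambda>b. e (2 * n * j + b)) (\<lambda>b. e (2 * n * j + (n + b))) s"
    unfolding gap_def using At_carrier[OF assms(1)] assms
    by (intro arg_cong2[of _ _ _ _ "(+)"] sum.cong)
      (auto simp: hatA_index block_index_less block_div_mod simp del: add.assoc)
  finally show ?thesis .
qed

lemma hatA_row_upper:
  assumes "j < N" "s < n"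
  shows "(\<Sum>c<M. hatA S $$ (2 * n * j + (n + s), c) * e c)
    = gap (At S j) (\<lambda>b. e (2 * n * j + (n + b))) (\<lambda>b. e (2 * n * j + b)) s"
proof -
  have "(\<Sum>c<M. hatA S $$ (2 * n * j + (n + s), c) * e c)
      = (\<Sum>b<n. hatA S $$ (2 * n * j + (n + s), 2 * n * j + b) * e (2 * n * j + b))
      + (\<Sum>b<n. hatA S $$ (2 * n * j + (n + s), 2 * n * j + (n + b)) * e (2 * n * j + (n + b)))"
    using assms block_index_less[of j "n + s"]
    by (intro sum_block) (auto simp: hatA_index block_div_mod)
  also have "\<dots> = gap (At S j) (\<lambda>b. e (2 * n * j + (n + b))) (\<lambda>b. e (2 * n * j + b)) s"
    unfolding gap_def using At_carrier[OF assms(1)] assms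
    by (subst add.commute, intro arg_cong2[of _ _ _ _ "(+)"] sum.cong)
      (auto simp: hatA_index block_index_less block_div_mod)
  finally show ?thesis .
qed

section \<open>Matrices in \<open>Hset\<close> as row selections\<close>

lemma select_row_mult:
  assumes "H \<in> carrier_mat M M" "row H r = unit_vec M q" "r < M" "q < M" "c < M"
  shows "(H * hatA S) $$ (r, c) = hatA S $$ (q, c)"
  using assms hatA_carrier by (simp add: scalar_prod_left_unit)

text \<open>Left multiplication by a matrix whose rows are unit vectors only picks rows of the other
  factor, so \<open>H\<close> can be traded for an index function \<open>h\<close>.\<close>

lemma Hset_imp_selection:
  assumes "H \<in> Hset S"
  obtains h where "\<And>r. r < M \<Longrightarrow> h r \<in> R r"
    "\<And>r c. r < M \<Longrightarrow> c < M \<Longrightarrow> (H * hatA S) $$ (r, c) = hatA S $$ (h r, c)"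
proof -
  have H: "H \<in> carrier_mat M M"
    and Hlo: "\<And>i s. i < N \<Longrightarrow> s < n \<Longrightarrow> \<exists>j\<in>nbhd S i. row H (2 * n * i + s) = unit_vec M (2 * n * j + s)"
    and Hhi: "\<And>i s. i < N \<Longrightarrow> s < n \<Longrightarrow>
      \<exists>j\<in>nbhd S i. row H (2 * n * i + n + s) = unit_vec M (2 * n * j + n + s)"
    using assms by (auto simp: Hset_def Let_def)
  have "\<exists>q\<in>R r. row H r = unit_vec M q" if r: "r < M" for r
  proof (cases "r mod (2 * n) < n")
    case True
    have "2 * n * (r div (2 * n)) + r mod (2 * n) = r" by simp
    then show ?thesis using Hlo[OF block_less[OF r] True] by (auto simp: R_def)
  next
    case False
    then have *: "x + n + (r mod (2 * n) - n) = x + r mod (2 * n)" for x by simp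
    have "r mod (2 * n) - n < n" using pos_less[of r] False by linarith
    then have "\<exists>j\<in>nbhd S (r div (2 * n)).
        row H (2 * n * (r div (2 * n)) + r mod (2 * n)) = unit_vec M (2 * n * j + r mod (2 * n))"
      using Hhi[OF block_less[OF r], of "r mod (2 * n) - n"] by (simp only: *)
    moreover have "2 * n * (r div (2 * n)) + r mod (2 * n) = r" by simp
    ultimately show ?thesis by (auto simp: R_def)
  qed
  then obtain h where h: "\<And>r. r < M \<Longrightarrow> h r \<in> R r \<and> row H r = unit_vec M (h r)"
    by metis
  show ?thesis
  proof
    show "h r \<in> R r" if "r < M" for r using h[OF that] by blast
    show "(H * hatA S) $$ (r, c) = hatA S $$ (h r, c)" if "r < M" "c < M" for r c
      using h[OF that(1)] select_row_mult[OF H _ that(1) _ that(2)] R_less[OF that(1)] by blast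
  qed
qed

text \<open>\<open>Hset\<close> imposes no coupling between different rows. Hence the minimizing
  rows, found separately for each component, assemble into one admissible matrix.\<close>

lemma selection_imp_Hset:
  assumes h: "\<And>r. r < M \<Longrightarrow> h r \<in> R r"
  obtains H where "H \<in> Hset S"
    "\<And>r c. r < M \<Longrightarrow> c < M \<Longrightarrow> (H * hatA S) $$ (r, c) = hatA S $$ (h r, c)"
proof -
  define H :: "real mat" where "H = mat M M (\<lambda>(r, c). if c = h r then 1 else 0)"
  have H: "H \<in> carrier_mat M M" by (simp add: H_def)
  have row: "row H r = unit_vec M (h r)" if "r < M" for r
    using that by (intro eq_vecI) (auto simp: H_def unit_vec_def)
  have ex: "\<exists>j\<in>nbhd S i. row H (2 * n * i + t) = unit_vec M (2 * n * j + t)"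
    if "i < N" "t < 2 * n" for i t
    using h[OF block_index_less[OF that]] row[OF block_index_less[OF that]]
    unfolding R_def block_div_mod[OF that(2)] by auto
  have "\<exists>j\<in>nbhd S i. row H (2 * n * i + s) = unit_vec M (2 * n * j + s)"
    and "\<exists>j\<in>nbhd S i. row H (2 * n * i + n + s) = unit_vec M (2 * n * j + n + s)"
    if "i < N" "s < n" for i s
    using ex[of i s] ex[of i "n + s"] that by (simp_all add: add.assoc)
  moreover have "\<forall>r<M. \<forall>c<M. H $$ (r, c) \<in> {0, 1}" by (simp add: H_def)
  ultimately have "H \<in> Hset S"
    using H by (simp add: Hset_def Let_def)
  then show ?thesis
    by (rule that) (rule select_row_mult[OF H row _ R_less[OF _ h]])
qed

end

section \<open>Error dynamics\<close>

text \<open>A maximum of lower framers becomes a minimum of lower errors. Together with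
  \<open>Min_diff_eq_Min\<close> this lets both halves of the error obey the same minimum
  rule.\<close>

lemma diff_Max_eq_Min:
  fixes c :: real
  assumes "finite A" "A \<noteq> {}"
  shows "c - Max (f ` A) = Min ((\<lambda>j. c - f j) ` A)"
proof (rule sym, rule Min_eqI)
  show "c - Max (f ` A) \<le> y" if "y \<in> (\<lambda>j. c - f j) ` A" for y
    using that assms by auto
  have "Max (f ` A) \<in> f ` A" using assms by (intro Max_in) auto
  then show "c - Max (f ` A) \<in> (\<lambda>j. c - f j) ` A" by auto
qed (use assms in auto)

lemma Min_diff_eq_Min:
  fixes c :: real
  assumes "finite A" "A \<noteq> {}"
  shows "Min (f ` A) - c = Min ((\<lambda>j. f j - c) ` A)"
proof (rule sym, rule Min_eqI)
  show "Min (f ` A) - c \<le> y" if "y \<in> (\<lambda>j. f j - c) ` A" for y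
    using that assms by auto
  have "Min (f ` A) \<in> f ` A" using assms by (intro Min_in) auto
  then show "Min (f ` A) - c \<in> (\<lambda>j. f j - c) ` A" by auto
qed (use assms in auto)

context wf_system
begin

text \<open>Summing nonnegative terms over all nodes and rows gives one bound valid for each of
  them.\<close>

definition noise_gain :: real where
  "noise_gain = (\<Sum>j<N. \<Sum>s<n. row_abs_sum (Tm S j * sB S) s
     + row_abs_sum (sL S j * sD S j) s + row_abs_sum (sG S j * sD S j) s)"

lemma noise_gain_ge:
  assumes "j < N" "s < n"
  shows "row_abs_sum (Tm S j * sB S) s + row_abs_sum (sL S j * sD S j) s
    + row_abs_sum (sG S j * sD S j) s \<le> noise_gain"
proof -
  let ?f = "\<lambda>j s. row_abs_sum (Tm S j * sB S) s + row_abs_sum (sL S j * sD S j) s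
    + row_abs_sum (sG S j * sD S j) s"
  have nonneg: "0 \<le> ?f j s" for j s by (simp add: row_abs_sum_nonneg)
  have "?f j s \<le> (\<Sum>s<n. ?f j s)"
    using assms nonneg by (intro member_le_sum[where f = "?f j"]) auto
  also have "\<dots> \<le> (\<Sum>j<N. \<Sum>s<n. ?f j s)"
    using assms nonneg by (intro member_le_sum[where f = "\<lambda>j. \<Sum>s<n. ?f j s"] sum_nonneg) auto
  finally show ?thesis by (simp add: noise_gain_def)
qed

lemma noise_gain_nonneg: "0 \<le> noise_gain"
  unfolding noise_gain_def by (intro sum_nonneg add_nonneg_nonneg row_abs_sum_nonneg)

text \<open>From \<open>x' = T x' + G C x'\<close>, eliminating \<open>C x\<close> and \<open>C x'\<close> through the outputs.\<close>
lemma output_injection: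
  assumes j: "j < N" and s: "s < n" and x: "x \<in> carrier_vec n" and w: "w \<in> carrier_vec (pw S)"
    and v: "v \<in> carrier_vec (qv S j)" and v': "v' \<in> carrier_vec (qv S j)"
    and x': "x' = sA S *\<^sub>v x + sB S *\<^sub>v w"
  shows "x' $ s = (At S j *\<^sub>v x) $ s + (Tm S j * sB S *\<^sub>v w) $ s
    + (sL S j *\<^sub>v (sC S j *\<^sub>v x + sD S j *\<^sub>v v)) $ s
    + (sG S j *\<^sub>v (sC S j *\<^sub>v x' + sD S j *\<^sub>v v')) $ s
    - (sL S j * sD S j *\<^sub>v v) $ s - (sG S j * sD S j *\<^sub>v v') $ s"
proof -
  note A = carriers(1) and B = carriers(2)
  note C = carriers(3)[OF j] and D = carriers(4)[OF j] and L = carriers(5)[OF j] and G = carriers(6)[OF j]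
  note T = Tm_carrier[OF j]
  have Ax: "sA S *\<^sub>v x \<in> carrier_vec n" and Bw: "sB S *\<^sub>v w \<in> carrier_vec n"
    using mult_mat_vec_carrier[OF A x] mult_mat_vec_carrier[OF B w] .
  have x'c: "x' \<in> carrier_vec n" unfolding x' using Ax Bw by simp
  have 1: "(sL S j *\<^sub>v (sC S j *\<^sub>v x + sD S j *\<^sub>v v)) $ s
      = (sL S j * sC S j *\<^sub>v x) $ s + (sL S j * sD S j *\<^sub>v v) $ s"
    using mult_add_distrib_mat_vec[OF L mult_mat_vec_carrier[OF C x] mult_mat_vec_carrier[OF D v]]
      assoc_mult_mat_vec[OF L C x] assoc_mult_mat_vec[OF L D v] L s
    by (simp del: index_mult_mat_vec)
  have 2: "(sG S j *\<^sub>v (sC S j *\<^sub>v x' + sD S j *\<^sub>v v')) $ s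
      = (sG S j * sC S j *\<^sub>v x') $ s + (sG S j * sD S j *\<^sub>v v') $ s"
    using mult_add_distrib_mat_vec[OF G mult_mat_vec_carrier[OF C x'c] mult_mat_vec_carrier[OF D v']]
      assoc_mult_mat_vec[OF G C x'c] assoc_mult_mat_vec[OF G D v'] G s
    by (simp del: index_mult_mat_vec)
  have 3: "(At S j *\<^sub>v x) $ s = (Tm S j *\<^sub>v (sA S *\<^sub>v x)) $ s - (sL S j * sC S j *\<^sub>v x) $ s"
    unfolding At_def
    using minus_mult_distrib_mat_vec[OF mult_carrier_mat[OF T A] product_carriers(2)[OF j] x]
      assoc_mult_mat_vec[OF T A x] product_carriers(2)[OF j] L s
    by (simp del: index_mult_mat_vec)
  have 4: "(Tm S j * sB S *\<^sub>v w) $ s = (Tm S j *\<^sub>v (sB S *\<^sub>v w)) $ s"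
    using assoc_mult_mat_vec[OF T B w] by simp
  \<comment> \<open>Facts 5 and 6 evaluate \<open>T x'\<close> in two ways. Facts 3 and 4 then
    replace \<open>T A x\<close> and \<open>T B w\<close>, and facts 1 and 2 bring in the
    outputs.\<close>
  have 5: "(Tm S j *\<^sub>v x') $ s = (Tm S j *\<^sub>v (sA S *\<^sub>v x)) $ s + (Tm S j *\<^sub>v (sB S *\<^sub>v w)) $ s"
    unfolding x' using mult_add_distrib_mat_vec[OF T Ax Bw] T s by (simp del: index_mult_mat_vec)
  have 6: "(Tm S j *\<^sub>v x') $ s = x' $ s - (sG S j * sC S j *\<^sub>v x') $ s"
    unfolding Tm_def
    using minus_mult_distrib_mat_vec[OF one_carrier_mat product_carriers(1)[OF j] x'c] x'c G s
    by (simp del: index_mult_mat_vec)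
  show ?thesis using 1 2 3 4 5 6 by linarith
qed

end

text \<open>An admissible realization. Keeping the run separate from \<open>wf_system\<close> allows
  constants fixed there to be uniform over all runs.\<close>

locale dio_run = wf_system +
  fixes wlo whi :: "real vec" and vlo vhi :: "nat \<Rightarrow> real vec" and xlo0 xhi0 x0 :: "real vec"
    and w :: "nat \<Rightarrow> real vec" and v :: "nat \<Rightarrow> nat \<Rightarrow> real vec"
  assumes wlo_dim: "dim_vec wlo = pw S"
    and vlo_dim: "\<And>i. i < nN S \<Longrightarrow> dim_vec (vlo i) = qv S i"
    and x0_dim: "dim_vec x0 = nx S"
    and x0_le: "vle xlo0 x0" "vle x0 xhi0"
    and w_le: "\<And>l. vle wlo (w l)" "\<And>l. vle (w l) whi"
    and v_le: "\<And>l i. i < nN S \<Longrightarrow> vle (vlo i) (v l i)" "\<And>l i. i < nN S \<Longrightarrow> vle (v l i) (vhi i)"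
begin

abbreviation X where "X \<equiv> traj S x0 w"
abbreviation Y where "Y \<equiv> outp S x0 w v"
definition LO where "LO k = fst (dio S wlo whi vlo vhi xlo0 xhi0 Y k)"
definition HI where "HI k = snd (dio S wlo whi vlo vhi xlo0 xhi0 Y k)"
definition LO0 where "LO0 k j = lo0 S wlo whi vlo vhi Y k (LO k j) (HI k j) j"
definition HI0 where "HI0 k j = hi0 S wlo whi vlo vhi Y k (LO k j) (HI k j) j"
definition E where "E = err S wlo whi vlo vhi xlo0 xhi0 x0 w v"
text \<open>Only the widths of the noise intervals in \<open>dnorm\<close> matter below; they are the same at every time.\<close>
definition noise where "noise = dnorm S wlo whi vlo vhi w v 0"

lemma dims [simp]:
  "dim_vec whi = pw S" "dim_vec wlo = pw S" "dim_vec (w l) = pw S"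
  "dim_vec xlo0 = n" "dim_vec xhi0 = n" "dim_vec x0 = n"
  using w_le[of l] w_le[of 0] x0_le wlo_dim x0_dim by (auto simp: vle_def)

lemma v_dims [simp]:
  assumes "i < N"
  shows "dim_vec (vhi i) = qv S i" "dim_vec (vlo i) = qv S i" "dim_vec (v l i) = qv S i"
  using v_le[OF assms] vlo_dim[OF assms] by (auto simp: vle_def)

lemma X_dim [simp]: "dim_vec (X k) = n"
  using carriers(1,2) by (cases k) auto

lemma LO_HI_Suc:
  "LO (Suc k) i = vec n (\<lambda>s. Max ((\<lambda>j. LO0 k j $ s) ` nbhd S i))"
  "HI (Suc k) i = vec n (\<lambda>s. Min ((\<lambda>j. HI0 k j $ s) ` nbhd S i))"
  by (simp_all add: LO_def HI_def LO0_def HI0_def case_prod_beta Let_def)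

lemma LO_HI_0 [simp]: "LO 0 i = xlo0" "HI 0 i = xhi0"
  by (simp_all add: LO_def HI_def)

lemma LO_HI_dim [simp]: "dim_vec (LO k i) = n" "dim_vec (HI k i) = n"
  by (cases k; simp add: LO_HI_Suc)+

lemma E_dim [simp]: "dim_vec (E k) = M"
  by (simp add: E_def err_def Let_def)

lemma E_index:
  assumes "r < M"
  shows "E k $ r = (if r mod (2 * n) < n
    then X k $ (r mod (2 * n)) - LO k (r div (2 * n)) $ (r mod (2 * n))
    else HI k (r div (2 * n)) $ (r mod (2 * n) - n) - X k $ (r mod (2 * n) - n))"
  using assms by (simp add: E_def err_def Let_def LO_def HI_def)

lemma E_lower:
  assumes "j < N" "b < n"
  shows "E k $ (2 * n * j + b) = X k $ b - LO k j $ b"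
  using assms block_index_less[of j b] block_div_mod[of b j] by (simp add: E_index)

lemma E_upper:
  assumes "j < N" "b < n"
  shows "E k $ (2 * n * j + (n + b)) = HI k j $ b - X k $ b"
  using assms block_index_less[of j "n + b"] block_div_mod[of "n + b" j] by (simp add: E_index)

text \<open>Errors of the preliminary framers \<open>lo0\<close> and \<open>hi0\<close>, before the network step.\<close>
definition pre :: "nat \<Rightarrow> nat \<Rightarrow> real" where
  "pre k q = (if q mod (2 * n) < n
    then X (Suc k) $ (q mod (2 * n)) - LO0 k (q div (2 * n)) $ (q mod (2 * n))
    else HI0 k (q div (2 * n)) $ (q mod (2 * n) - n) - X (Suc k) $ (q mod (2 * n) - n))"

lemma E_Suc:
  assumes r: "r < M"
  shows "E (Suc k) $ r = Min (pre k ` R r)"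
proof -
  let ?i = "r div (2 * n)" and ?t = "r mod (2 * n)"
  have fin: "finite (nbhd S ?i)" "nbhd S ?i \<noteq> {}"
    using finite_nbhd[OF block_less[OF r]] nbhd_self by blast+
  have t: "?t < 2 * n" by (rule pos_less)
  have R: "pre k ` R r = (\<lambda>j. pre k (2 * n * j + ?t)) ` nbhd S ?i"
    by (simp only: R_def image_image)
  show ?thesis
  proof (cases "?t < n")
    case True
    have "E (Suc k) $ r = X (Suc k) $ ?t - Max ((\<lambda>j. LO0 k j $ ?t) ` nbhd S ?i)"
      unfolding E_index[OF r] LO_HI_Suc using True by (simp del: traj.simps)
    also have "\<dots> = Min ((\<lambda>j. X (Suc k) $ ?t - LO0 k j $ ?t) ` nbhd S ?i)"
      by (rule diff_Max_eq_Min[OF fin])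
    also have "\<dots> = Min (pre k ` R r)"
      unfolding R pre_def block_div_mod[OF t] using True by (simp only: if_True)
    finally show ?thesis .
  next
    case False
    then have "?t - n < n" using t by linarith
    then have "E (Suc k) $ r = Min ((\<lambda>j. HI0 k j $ (?t - n)) ` nbhd S ?i) - X (Suc k) $ (?t - n)"
      unfolding E_index[OF r] LO_HI_Suc using False by (simp del: traj.simps)
    also have "\<dots> = Min ((\<lambda>j. HI0 k j $ (?t - n) - X (Suc k) $ (?t - n)) ` nbhd S ?i)"
      by (rule Min_diff_eq_Min[OF fin])
    also have "\<dots> = Min (pre k ` R r)"
      unfolding R pre_def block_div_mod[OF t] using False by (simp only: if_False)
    finally show ?thesis .
  qed
qed

lemma X_Suc_index:
  assumes "j < N" "s < n"
  shows "X (Suc k) $ s = (At S j *\<^sub>v X k) $ s + (Tm S j * sB S *\<^sub>v w k) $ s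
    + (sL S j *\<^sub>v Y k j) $ s + (sG S j *\<^sub>v Y (Suc k) j) $ s
    - (sL S j * sD S j *\<^sub>v v k j) $ s - (sG S j * sD S j *\<^sub>v v (Suc k) j) $ s"
  unfolding outp_def
  by (rule output_injection) (use assms in \<open>auto intro: carrier_vecI\<close>)

text \<open>The output terms of the framer cancel against those of \<open>X_Suc_index\<close>, and
  every remaining matrix leaves one \<open>gap\<close>. Measurement noise enters the state with a
  minus sign, so its terms come from \<open>gap_upper\<close> while the others come from
  \<open>gap_lower\<close>.\<close>

lemma pre_error_lower:
  assumes j: "j < N" and s: "s < n"
  shows "X (Suc k) $ s - LO0 k j $ s
    = gap (At S j) (\<lambda>c. X k $ c - LO k j $ c) (\<lambda>c. HI k j $ c - X k $ c) s
    + gap (Tm S j * sB S) (\<lambda>c. w k $ c - wlo $ c) (\<lambda>c. whi $ c - w k $ c) s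
    + gap (sL S j * sD S j) (\<lambda>c. vhi j $ c - v k j $ c) (\<lambda>c. v k j $ c - vlo j $ c) s
    + gap (sG S j * sD S j) (\<lambda>c. vhi j $ c - v (Suc k) j $ c) (\<lambda>c. v (Suc k) j $ c - vlo j $ c) s"
proof -
  note At = At_carrier[OF j] and TB = TB_carrier[OF j]
  note LD = product_carriers(4)[OF j] and GD = product_carriers(3)[OF j]
  note L = carriers(5)[OF j] and G = carriers(6)[OF j]
  have vc: "vhi j \<in> carrier_vec (qv S j)" "vlo j \<in> carrier_vec (qv S j)"
    using j by (auto intro: carrier_vecI)
  have "LO0 k j $ s = (posm (At S j) *\<^sub>v LO k j) $ s - (negm (At S j) *\<^sub>v HI k j) $ s
     + (posm (Tm S j * sB S) *\<^sub>v wlo) $ s - (negm (Tm S j * sB S) *\<^sub>v whi) $ s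
     + (sL S j *\<^sub>v Y k j) $ s + (sG S j *\<^sub>v Y (Suc k) j) $ s
     - ((posm (sL S j * sD S j) *\<^sub>v vhi j) $ s + (posm (sG S j * sD S j) *\<^sub>v vhi j) $ s)
     + ((negm (sL S j * sD S j) *\<^sub>v vlo j) $ s + (negm (sG S j * sD S j) *\<^sub>v vlo j) $ s)"
    unfolding LO0_def lo0_def
      add_mult_distrib_mat_vec[OF posm_carrier[OF LD] posm_carrier[OF GD] vc(1)]
      add_mult_distrib_mat_vec[OF negm_carrier[OF LD] negm_carrier[OF GD] vc(2)]
    using At TB Tm_carrier[OF j] LD GD L G s by (simp del: index_mult_mat_vec)
  moreover have "(At S j *\<^sub>v X k) $ s - (posm (At S j) *\<^sub>v LO k j) $ s + (negm (At S j) *\<^sub>v HI k j) $ s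
      = gap (At S j) (\<lambda>c. X k $ c - LO k j $ c) (\<lambda>c. HI k j $ c - X k $ c) s"
    using At s by (intro gap_lower) auto
  moreover have "(Tm S j * sB S *\<^sub>v w k) $ s - (posm (Tm S j * sB S) *\<^sub>v wlo) $ s
        + (negm (Tm S j * sB S) *\<^sub>v whi) $ s
      = gap (Tm S j * sB S) (\<lambda>c. w k $ c - wlo $ c) (\<lambda>c. whi $ c - w k $ c) s"
    using carrier_matD[OF TB] s by (intro gap_lower) auto
  moreover have "(posm (sL S j * sD S j) *\<^sub>v vhi j) $ s - (negm (sL S j * sD S j) *\<^sub>v vlo j) $ s
        - (sL S j * sD S j *\<^sub>v v k j) $ s
      = gap (sL S j * sD S j) (\<lambda>c. vhi j $ c - v k j $ c) (\<lambda>c. v k j $ c - vlo j $ c) s"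
    using carrier_matD[OF LD] s j by (intro gap_upper) auto
  moreover have "(posm (sG S j * sD S j) *\<^sub>v vhi j) $ s - (negm (sG S j * sD S j) *\<^sub>v vlo j) $ s
        - (sG S j * sD S j *\<^sub>v v (Suc k) j) $ s
      = gap (sG S j * sD S j) (\<lambda>c. vhi j $ c - v (Suc k) j $ c) (\<lambda>c. v (Suc k) j $ c - vlo j $ c) s"
    using carrier_matD[OF GD] s j by (intro gap_upper) auto
  ultimately show ?thesis
    using X_Suc_index[OF assms, of k] by linarith
qed

lemma pre_error_upper:
  assumes j: "j < N" and s: "s < n"
  shows "HI0 k j $ s - X (Suc k) $ s
    = gap (At S j) (\<lambda>c. HI k j $ c - X k $ c) (\<lambda>c. X k $ c - LO k j $ c) s
    + gap (Tm S j * sB S) (\<lambda>c. whi $ c - w k $ c) (\<lambda>c. w k $ c - wlo $ c) s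
    + gap (sL S j * sD S j) (\<lambda>c. v k j $ c - vlo j $ c) (\<lambda>c. vhi j $ c - v k j $ c) s
    + gap (sG S j * sD S j) (\<lambda>c. v (Suc k) j $ c - vlo j $ c) (\<lambda>c. vhi j $ c - v (Suc k) j $ c) s"
proof -
  note At = At_carrier[OF j] and TB = TB_carrier[OF j]
  note LD = product_carriers(4)[OF j] and GD = product_carriers(3)[OF j]
  note L = carriers(5)[OF j] and G = carriers(6)[OF j]
  have vc: "vhi j \<in> carrier_vec (qv S j)" "vlo j \<in> carrier_vec (qv S j)"
    using j by (auto intro: carrier_vecI)
  have "HI0 k j $ s = (posm (At S j) *\<^sub>v HI k j) $ s - (negm (At S j) *\<^sub>v LO k j) $ s
     + (posm (Tm S j * sB S) *\<^sub>v whi) $ s - (negm (Tm S j * sB S) *\<^sub>v wlo) $ s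
     + (sL S j *\<^sub>v Y k j) $ s + (sG S j *\<^sub>v Y (Suc k) j) $ s
     - ((posm (sL S j * sD S j) *\<^sub>v vlo j) $ s + (posm (sG S j * sD S j) *\<^sub>v vlo j) $ s)
     + ((negm (sL S j * sD S j) *\<^sub>v vhi j) $ s + (negm (sG S j * sD S j) *\<^sub>v vhi j) $ s)"
    unfolding HI0_def hi0_def
      add_mult_distrib_mat_vec[OF posm_carrier[OF LD] posm_carrier[OF GD] vc(2)]
      add_mult_distrib_mat_vec[OF negm_carrier[OF LD] negm_carrier[OF GD] vc(1)]
    using At TB Tm_carrier[OF j] LD GD L G s by (simp del: index_mult_mat_vec)
  moreover have "(posm (At S j) *\<^sub>v HI k j) $ s - (negm (At S j) *\<^sub>v LO k j) $ s - (At S j *\<^sub>v X k) $ s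
      = gap (At S j) (\<lambda>c. HI k j $ c - X k $ c) (\<lambda>c. X k $ c - LO k j $ c) s"
    using At s by (intro gap_upper) auto
  moreover have "(posm (Tm S j * sB S) *\<^sub>v whi) $ s - (negm (Tm S j * sB S) *\<^sub>v wlo) $ s
        - (Tm S j * sB S *\<^sub>v w k) $ s
      = gap (Tm S j * sB S) (\<lambda>c. whi $ c - w k $ c) (\<lambda>c. w k $ c - wlo $ c) s"
    using carrier_matD[OF TB] s by (intro gap_upper) auto
  moreover have "(sL S j * sD S j *\<^sub>v v k j) $ s - (posm (sL S j * sD S j) *\<^sub>v vlo j) $ s
        + (negm (sL S j * sD S j) *\<^sub>v vhi j) $ s
      = gap (sL S j * sD S j) (\<lambda>c. v k j $ c - vlo j $ c) (\<lambda>c. vhi j $ c - v k j $ c) s"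
    using carrier_matD[OF LD] s j by (intro gap_lower) auto
  moreover have "(sG S j * sD S j *\<^sub>v v (Suc k) j) $ s - (posm (sG S j * sD S j) *\<^sub>v vlo j) $ s
        + (negm (sG S j * sD S j) *\<^sub>v vhi j) $ s
      = gap (sG S j * sD S j) (\<lambda>c. v (Suc k) j $ c - vlo j $ c) (\<lambda>c. vhi j $ c - v (Suc k) j $ c) s"
    using carrier_matD[OF GD] s j by (intro gap_lower) auto
  ultimately show ?thesis
    using X_Suc_index[OF assms, of k] by linarith
qed

section \<open>Noise bounds and the error recursion\<close>

lemma noise_nonneg: "0 \<le> noise"
  by (simp add: noise_def dnorm_def sum_nonneg)

lemma w_bounds:
  assumes "c < pw S"
  shows "0 \<le> w l $ c - wlo $ c" "0 \<le> whi $ c - w l $ c"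
    "w l $ c - wlo $ c \<le> noise" "whi $ c - w l $ c \<le> noise"
proof -
  show 0: "0 \<le> w l $ c - wlo $ c" "0 \<le> whi $ c - w l $ c"
    using w_le[of l] assms by (auto simp: vle_def)
  have "vnorm (whi - wlo) \<le> noise"
    unfolding noise_def dnorm_def by (rule real_le_rsqrt) (simp add: sum_nonneg)
  moreover have "\<bar>(whi - wlo) $ c\<bar> \<le> vnorm (whi - wlo)"
    using assms by (intro component_le_vnorm) simp
  ultimately have "whi $ c - wlo $ c \<le> noise" using assms by simp
  then show "w l $ c - wlo $ c \<le> noise" "whi $ c - w l $ c \<le> noise"
    using 0 by linarith+
qed

lemma v_bounds:
  assumes "j < N" "c < qv S j"
  shows "0 \<le> v l j $ c - vlo j $ c" "0 \<le> vhi j $ c - v l j $ c"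
    "v l j $ c - vlo j $ c \<le> noise" "vhi j $ c - v l j $ c \<le> noise"
proof -
  show 0: "0 \<le> v l j $ c - vlo j $ c" "0 \<le> vhi j $ c - v l j $ c"
    using v_le[OF assms(1), of l] assms by (auto simp: vle_def)
  have "(vnorm (vhi j - vlo j))\<^sup>2 \<le> (\<Sum>i<N. (vnorm (vhi i - vlo i))\<^sup>2)"
    using assms(1) by (intro member_le_sum[where f = "\<lambda>i. (vnorm (vhi i - vlo i))\<^sup>2"]) auto
  then have "vnorm (vhi j - vlo j) \<le> noise"
    unfolding noise_def dnorm_def by (intro real_le_rsqrt) (simp add: sum_nonneg add_nonneg_nonneg add_increasing)
  moreover have "\<bar>(vhi j - vlo j) $ c\<bar> \<le> vnorm (vhi j - vlo j)"
    using assms by (intro component_le_vnorm) simp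
  ultimately have "vhi j $ c - vlo j $ c \<le> noise" using assms by simp
  then show "v l j $ c - vlo j $ c \<le> noise" "vhi j $ c - v l j $ c \<le> noise"
    using 0 by linarith+
qed

text \<open>The distances are left arbitrary so that one proof covers lower and upper errors, in
  which they trade places.\<close>

lemma noise_terms_bounds:
  assumes j: "j < N" and s: "s < n"
    and f: "\<And>c. c < pw S \<Longrightarrow> 0 \<le> f c \<and> f c \<le> noise" "\<And>c. c < pw S \<Longrightarrow> 0 \<le> f' c \<and> f' c \<le> noise"
    and g: "\<And>c. c < qv S j \<Longrightarrow> 0 \<le> g c \<and> g c \<le> noise" "\<And>c. c < qv S j \<Longrightarrow> 0 \<le> g' c \<and> g' c \<le> noise"
    and h: "\<And>c. c < qv S j \<Longrightarrow> 0 \<le> h c \<and> h c \<le> noise" "\<And>c. c < qv S j \<Longrightarrow> 0 \<le> h' c \<and> h' c \<le> noise"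
  defines "G \<equiv> gap (Tm S j * sB S) f f' s + gap (sL S j * sD S j) g g' s + gap (sG S j * sD S j) h h' s"
  shows "0 \<le> G" "G \<le> noise_gain * noise"
proof -
  note TB = carrier_matD[OF TB_carrier[OF j]]
  note LD = carrier_matD[OF product_carriers(4)[OF j]] and GD = carrier_matD[OF product_carriers(3)[OF j]]
  show "0 \<le> G"
    unfolding G_def by (intro add_nonneg_nonneg gap_nonneg) (use TB LD GD s f g h in auto)
  have "G \<le> row_abs_sum (Tm S j * sB S) s * noise + row_abs_sum (sL S j * sD S j) s * noise
      + row_abs_sum (sG S j * sD S j) s * noise"
    unfolding G_def by (intro add_mono gap_le) (use TB LD GD s f g h in auto)
  also have "\<dots> \<le> noise_gain * noise"
    unfolding distrib_right[symmetric] by (rule mult_right_mono[OF noise_gain_ge[OF j s] noise_nonneg])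
  finally show "G \<le> noise_gain * noise" .
qed

text \<open>The lower bound propagates nonnegativity of the errors, the upper bound feeds the
  comparison argument, and for zero noise the two coincide and give the exact dynamics.\<close>

lemma pre_bounds:
  assumes q: "q < M"
  shows "(\<Sum>c<M. hatA S $$ (q, c) * E k $ c) \<le> pre k q"
    "pre k q \<le> (\<Sum>c<M. hatA S $$ (q, c) * E k $ c) + noise_gain * noise"
proof -
  define j s where "j = q div (2 * n)" and "s = (if q mod (2 * n) < n then q mod (2 * n) else q mod (2 * n) - n)"
  have j: "j < N" unfolding j_def by (rule block_less[OF q])
  have s: "s < n" unfolding s_def using pos_less[of q] by auto
  have At: "dim_col (At S j) = n" using At_carrier[OF j] by simp
  have "(\<Sum>c<M. hatA S $$ (q, c) * E k $ c) \<le> pre k q \<and>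
    pre k q \<le> (\<Sum>c<M. hatA S $$ (q, c) * E k $ c) + noise_gain * noise"
  proof (cases "q mod (2 * n) < n")
    case True
    have q': "q = 2 * n * j + s" using True by (simp add: j_def s_def)
    have pre: "pre k q = X (Suc k) $ s - LO0 k j $ s"
      unfolding pre_def using True by (simp only: j_def s_def if_True)
    have "(\<Sum>c<M. hatA S $$ (q, c) * E k $ c)
        = gap (At S j) (\<lambda>c. X k $ c - LO k j $ c) (\<lambda>c. HI k j $ c - X k $ c) s"
      unfolding q' hatA_row_lower[OF j s] using j by (simp add: gap_def At E_lower E_upper)
    then show ?thesis
      unfolding pre pre_error_lower[OF j s]
      using noise_terms_bounds[OF j s, of "\<lambda>c. w k $ c - wlo $ c" "\<lambda>c. whi $ c - w k $ c"
          "\<lambda>c. vhi j $ c - v k j $ c" "\<lambda>c. v k j $ c - vlo j $ c"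
          "\<lambda>c. vhi j $ c - v (Suc k) j $ c" "\<lambda>c. v (Suc k) j $ c - vlo j $ c"]
        w_bounds[of _ k] v_bounds[OF j, of _ k] v_bounds[OF j, of _ "Suc k"] by simp
  next
    case False
    have q': "q = 2 * n * j + (n + s)" using False by (simp add: j_def s_def)
    have pre: "pre k q = HI0 k j $ s - X (Suc k) $ s"
      unfolding pre_def using False by (simp only: j_def s_def if_False)
    have "(\<Sum>c<M. hatA S $$ (q, c) * E k $ c)
        = gap (At S j) (\<lambda>c. HI k j $ c - X k $ c) (\<lambda>c. X k $ c - LO k j $ c) s"
      unfolding q' hatA_row_upper[OF j s] using j by (simp add: gap_def At E_lower E_upper)
    then show ?thesis
      unfolding pre pre_error_upper[OF j s]
      using noise_terms_bounds[OF j s, of "\<lambda>c. whi $ c - w k $ c" "\<lambda>c. w k $ c - wlo $ c"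
          "\<lambda>c. v k j $ c - vlo j $ c" "\<lambda>c. vhi j $ c - v k j $ c"
          "\<lambda>c. v (Suc k) j $ c - vlo j $ c" "\<lambda>c. vhi j $ c - v (Suc k) j $ c"]
        w_bounds[of _ k] v_bounds[OF j, of _ k] v_bounds[OF j, of _ "Suc k"] by simp
  qed
  then show "(\<Sum>c<M. hatA S $$ (q, c) * E k $ c) \<le> pre k q"
    "pre k q \<le> (\<Sum>c<M. hatA S $$ (q, c) * E k $ c) + noise_gain * noise" by auto
qed

text \<open>The row \<open>q\<close> is a free choice, since a minimum lies below each competitor. A
  fixed \<open>H\<close> therefore dominates the run although the actual selection varies with the
  data.\<close>

lemma E_Suc_le:
  assumes "r < M" "q \<in> R r"
  shows "E (Suc k) $ r \<le> (\<Sum>c<M. hatA S $$ (q, c) * E k $ c) + noise_gain * noise"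
proof -
  have "E (Suc k) $ r \<le> pre k q"
    unfolding E_Suc[OF assms(1)] using assms finite_R by (intro Min_le) auto
  then show ?thesis using pre_bounds(2)[OF R_less[OF assms], of k] by linarith
qed

text \<open>The framer property: the state stays between the bounds because nonnegative coefficients
  and noise terms propagate the initial enclosure. It lets upper bounds on components control the
  norm.\<close>

lemma E_nonneg: "r < M \<Longrightarrow> 0 \<le> E k $ r"
proof (induction k arbitrary: r)
  case 0
  have "r mod (2 * n) - n < n" using pos_less[of r] n_pos by linarith
  then show ?case
    unfolding E_index[OF 0] using x0_le by (simp add: vle_def)
next
  case (Suc k)
  have "0 \<le> pre k q" if "q \<in> R r" for q
  proof -
    have q: "q < M" using R_less[OF Suc.prems that] .
    have "0 \<le> (\<Sum>c<M. hatA S $$ (q, c) * E k $ c)"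
      using Suc.IH q by (intro sum_nonneg mult_nonneg_nonneg) (auto simp: hatA_nonneg)
    then show ?thesis using pre_bounds(1)[OF q, of k] by linarith
  qed
  then show ?case
    unfolding E_Suc[OF Suc.prems] using finite_R[OF Suc.prems] R_nonempty[OF Suc.prems]
    by (subst Min_ge_iff) auto
qed

lemma E_Suc_noise_free:
  assumes "noise = 0" "r < M"
  shows "E (Suc k) $ r = step (\<lambda>c. E k $ c) r"
proof -
  have "pre k q = (\<Sum>c<M. hatA S $$ (q, c) * E k $ c)" if "q \<in> R r" for q
    using pre_bounds[OF R_less[OF assms(2) that], of k] assms(1) by simp
  then show ?thesis
    unfolding E_Suc[OF assms(2)] step_def by (simp cong: image_cong_simp)
qed

end

section \<open>Stability\<close>

lemma vnorm_zero [simp]: "vnorm (0\<^sub>v m) = 0"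
  by (simp add: vnorm_def)

context wf_system
begin

text \<open>One estimate serves both notions of stability: the noise term vanishes in the noise-free
  case and becomes the gain in the other.\<close>

lemma schur_stable_imp_estimate:
  assumes H: "H \<in> Hset S" and schur: "schur_stable (H * hatA S)"
  obtains C lam where "0 < C" "0 < lam" "lam < 1"
    "\<And>wlo whi vlo vhi xlo0 xhi0 x0 w v k. dio_run S wlo whi vlo vhi xlo0 xhi0 x0 w v \<Longrightarrow>
      vnorm (err S wlo whi vlo vhi xlo0 xhi0 x0 w v k)
        \<le> C * lam ^ k * vnorm (err S wlo whi vlo vhi xlo0 xhi0 x0 w v 0)
          + C * dnorm S wlo whi vlo vhi w v 0"
proof -
  let ?P = "H * hatA S"
  obtain h where h: "\<And>r. r < M \<Longrightarrow> h r \<in> R r"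
    and P_index: "\<And>r c. r < M \<Longrightarrow> c < M \<Longrightarrow> ?P $$ (r, c) = hatA S $$ (h r, c)"
    using Hset_imp_selection[OF H] by blast
  have P: "?P \<in> carrier_mat M M"
    using H hatA_carrier by (auto simp: Hset_def Let_def)
  have P_nonneg: "0 \<le> ?P $$ (r, c)" if "r < M" "c < M" for r c
    unfolding P_index[OF that] using hatA_nonneg[OF R_less[OF that(1) h[OF that(1)]] that(2)] .
  obtain C lam where C: "0 < C" "0 < lam" "lam < 1"
    and decay: "\<And>e eta delta k r.
      (\<And>k r. r < M \<Longrightarrow> e (Suc k) r \<le> (\<Sum>c<M. ?P $$ (r, c) * e k c) + eta) \<Longrightarrow> 0 \<le> eta \<Longrightarrow>
      (\<And>c. c < M \<Longrightarrow> 0 \<le> e 0 c \<and> e 0 c \<le> delta) \<Longrightarrow> r < M \<Longrightarrow>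
      e k r \<le> C * lam ^ k * delta + C * eta"
    using schur_stable_imp_decay[OF P M_pos schur P_nonneg] by blast
  \<comment> \<open>\<open>real M\<close> pays for passing from components to the norm, and
    \<open>1 + noise_gain\<close> lets one constant dominate the transient and the noise
    term.\<close>
  define K where "K = real M * C * (1 + noise_gain)"
  have MC: "0 < real M * C" using C M_pos by simp
  show ?thesis
  proof
    show "0 < K" unfolding K_def using noise_gain_nonneg by (intro mult_pos_pos[OF MC]) simp
    show "0 < lam" "lam < 1" using C by auto
    fix wlo whi vlo vhi xlo0 xhi0 x0 w v k
    assume "dio_run S wlo whi vlo vhi xlo0 xhi0 x0 w v"
    then interpret dio_run S wlo whi vlo vhi xlo0 xhi0 x0 w v .
    let ?d = "vnorm (E 0)"
    have "E k $ r \<le> C * lam ^ k * ?d + C * (noise_gain * noise)" if "r < M" for r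
    proof (rule decay[of "\<lambda>k r. E k $ r"])
      show "E (Suc k) $ r \<le> (\<Sum>c<M. ?P $$ (r, c) * E k $ c) + noise_gain * noise" if "r < M" for k r
        using E_Suc_le[OF that h[OF that], of k] P_index[OF that] by simp
      show "0 \<le> noise_gain * noise" using noise_gain_nonneg noise_nonneg by simp
      show "0 \<le> E 0 $ c \<and> E 0 $ c \<le> ?d" if "c < M" for c
        using E_nonneg[OF that, of 0] component_le_vnorm[of c "E 0"] that by simp
    qed fact
    then have "vnorm (E k) \<le> real M * (C * lam ^ k * ?d + C * (noise_gain * noise))"
      using vnorm_le[of "E k"] E_nonneg[of _ k] by (simp add: abs_of_nonneg)
    also have "\<dots> = real M * C * (lam ^ k * ?d) + real M * C * noise_gain * noise"
      by (simp add: algebra_simps)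
    also have "\<dots> \<le> K * (lam ^ k * ?d) + K * noise"
      unfolding K_def using MC noise_gain_nonneg noise_nonneg C vnorm_nonneg[of "E 0"]
      by (intro add_mono mult_right_mono) (auto simp: algebra_simps)
    finally show "vnorm (err S wlo whi vlo vhi xlo0 xhi0 x0 w v k)
        \<le> K * lam ^ k * vnorm (err S wlo whi vlo vhi xlo0 xhi0 x0 w v 0)
          + K * dnorm S wlo whi vlo vhi w v 0"
      by (simp add: E_def noise_def mult.assoc)
  qed
qed

text \<open>The state rests at 0 inside the initial interval from -1 to 1, so the initial error is
  the all-ones vector from which \<open>decay_imp_contracting_selection\<close> starts.\<close>

abbreviation unit_err :: "nat \<Rightarrow> real vec" where
  "unit_err \<equiv> err S (0\<^sub>v (pw S)) (0\<^sub>v (pw S)) (\<lambda>i. 0\<^sub>v (qv S i)) (\<lambda>i. 0\<^sub>v (qv S i))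
     (vec n (\<lambda>_. - 1)) (vec n (\<lambda>_. 1)) (0\<^sub>v n) (\<lambda>k. 0\<^sub>v (pw S)) (\<lambda>k i. 0\<^sub>v (qv S i))"

lemma dnorm_zero:
  "dnorm S (0\<^sub>v (pw S)) (0\<^sub>v (pw S)) (\<lambda>i. 0\<^sub>v (qv S i)) (\<lambda>i. 0\<^sub>v (qv S i))
    (\<lambda>k. 0\<^sub>v (pw S)) (\<lambda>k i. 0\<^sub>v (qv S i)) l = 0"
  by (simp add: dnorm_def)

text \<open>Both notions of stability force this single run to decay, so both converse directions
  pass through here.\<close>

lemma unit_err_decay_imp_schur_stable:
  assumes "(\<lambda>k. vnorm (unit_err k)) \<longlonglongrightarrow> 0"
  shows "\<exists>H\<in>Hset S. schur_stable (H * hatA S)"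
proof -
  interpret dio_run S "0\<^sub>v (pw S)" "0\<^sub>v (pw S)" "\<lambda>i. 0\<^sub>v (qv S i)" "\<lambda>i. 0\<^sub>v (qv S i)"
     "vec n (\<lambda>_. - 1)" "vec n (\<lambda>_. 1)" "0\<^sub>v n" "\<lambda>k. 0\<^sub>v (pw S)" "\<lambda>k i. 0\<^sub>v (qv S i)"
    by unfold_locales (auto simp: vle_def)
  have noise: "noise = 0" by (simp add: noise_def dnorm_zero)
  have e0: "E 0 $ r = 1" if "r < M" for r
  proof -
    have "r mod (2 * n) - n < n" using pos_less[of r] n_pos by linarith
    then show ?thesis unfolding E_index[OF that] by simp
  qed
  have lim: "(\<lambda>k. E k $ r) \<longlonglongrightarrow> 0" if "r < M" for r
  proof (rule tendsto_sandwich)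
    show "\<forall>\<^sub>F k in sequentially. 0 \<le> E k $ r"
      using E_nonneg[OF that] by simp
    show "\<forall>\<^sub>F k in sequentially. E k $ r \<le> vnorm (E k)"
      using component_le_vnorm[of r "E _"] that by (simp add: abs_le_iff)
    show "(\<lambda>k. vnorm (E k)) \<longlonglongrightarrow> 0" using assms by (simp add: E_def)
  qed simp
  obtain lam h u where "lam < 1"
    and h: "\<And>r. r < M \<Longrightarrow> h r \<in> R r"
    and u: "\<And>r. r < M \<Longrightarrow> 0 < u r"
    and contr: "\<And>r. r < M \<Longrightarrow> (\<Sum>c<M. hatA S $$ (h r, c) * u c) \<le> lam * u r"
    by (rule decay_imp_contracting_selection[of "\<lambda>k r. E k $ r", OF e0 E_Suc_noise_free[OF noise] lim])
      (assumption | rule that)+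
  obtain H where H: "H \<in> Hset S"
    and P_index: "\<And>r c. r < M \<Longrightarrow> c < M \<Longrightarrow> (H * hatA S) $$ (r, c) = hatA S $$ (h r, c)"
    by (rule selection_imp_Hset[OF h]) (assumption | rule that)+
  have "schur_stable (H * hatA S)"
  proof (rule contracting_imp_schur_stable[OF _ M_pos _ u _ \<open>lam < 1\<close>])
    show "H * hatA S \<in> carrier_mat M M"
      using H hatA_carrier by (auto simp: Hset_def Let_def)
    show "0 \<le> (H * hatA S) $$ (r, c)" if "r < M" "c < M" for r c
      unfolding P_index[OF that] using hatA_nonneg[OF R_less[OF that(1) h[OF that(1)]] that(2)] .
    show "(\<Sum>c<M. (H * hatA S) $$ (r, c) * u c) \<le> lam * u r" if "r < M" for r
      using contr[OF that] P_index[OF that] by simp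
  qed
  with H show ?thesis by blast
qed

section \<open>The four implications\<close>

lemma GES_imp_schur_stable:
  assumes "GES_noise_free S"
  shows "\<exists>H\<in>Hset S. schur_stable (H * hatA S)"
proof -
  obtain c lam where lam: "0 < lam" "lam < 1"
    and "\<forall>x0 xlo0 xhi0 k. dim_vec x0 = n \<longrightarrow> vle xlo0 x0 \<longrightarrow> vle x0 xhi0 \<longrightarrow>
        vnorm (err S (0\<^sub>v (pw S)) (0\<^sub>v (pw S)) (\<lambda>i. 0\<^sub>v (qv S i)) (\<lambda>i. 0\<^sub>v (qv S i))
                  xlo0 xhi0 x0 (\<lambda>k. 0\<^sub>v (pw S)) (\<lambda>k i. 0\<^sub>v (qv S i)) k)
        \<le> c * lam ^ k *
          vnorm (err S (0\<^sub>v (pw S)) (0\<^sub>v (pw S)) (\<lambda>i. 0\<^sub>v (qv S i)) (\<lambda>i. 0\<^sub>v (qv S i))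
                  xlo0 xhi0 x0 (\<lambda>k. 0\<^sub>v (pw S)) (\<lambda>k i. 0\<^sub>v (qv S i)) 0)"
    using assms unfolding GES_noise_free_def by (elim exE conjE) (assumption | rule that)+
  then have bound: "vnorm (unit_err k) \<le> c * lam ^ k * vnorm (unit_err 0)" for k
    by (simp add: vle_def)
  have "(\<lambda>k. c * lam ^ k * vnorm (unit_err 0)) \<longlonglongrightarrow> c * 0 * vnorm (unit_err 0)"
    using lam by (intro tendsto_intros LIMSEQ_realpow_zero) auto
  then have "(\<lambda>k. vnorm (unit_err k)) \<longlonglongrightarrow> 0"
    unfolding mult_zero_right mult_zero_left
    by (rule tendsto_sandwich[OF _ _ tendsto_const, rotated 2]) (simp_all add: vnorm_nonneg bound)
  then show ?thesis by (rule unit_err_decay_imp_schur_stable)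
qed

lemma ISS_imp_schur_stable:
  assumes "ISS S"
  shows "\<exists>H\<in>Hset S. schur_stable (H * hatA S)"
proof -
  obtain \<beta> \<gamma> where KL: "class_KL \<beta>" and Kinf: "class_Kinf \<gamma>"
    and iss: "\<forall>wlo whi vlo vhi xlo0 xhi0 x0 w v k.
        dim_vec wlo = pw S \<longrightarrow> vle wlo whi \<longrightarrow>
        (\<forall>i<N. dim_vec (vlo i) = qv S i \<and> vle (vlo i) (vhi i)) \<longrightarrow>
        dim_vec x0 = n \<longrightarrow> vle xlo0 x0 \<longrightarrow> vle x0 xhi0 \<longrightarrow>
        (\<forall>l. vle wlo (w l) \<and> vle (w l) whi) \<longrightarrow>
        (\<forall>l. \<forall>i<N. vle (vlo i) (v l i) \<and> vle (v l i) (vhi i)) \<longrightarrow>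
        vnorm (err S wlo whi vlo vhi xlo0 xhi0 x0 w v k)
          \<le> \<beta> (vnorm (err S wlo whi vlo vhi xlo0 xhi0 x0 w v 0)) k
            + \<gamma> (Max ((dnorm S wlo whi vlo vhi w v) ` {0..k}))"
    using assms unfolding ISS_def by (elim exE conjE) (assumption | rule that)+
  \<comment> \<open>Along the noise-free run the gain term is \<gamma> at 0, so only the \<beta>
    term remains, and it tends to zero.\<close>
  have "\<gamma> 0 = 0" using Kinf by (simp add: class_Kinf_def class_K_def)
  have "Max ((dnorm S (0\<^sub>v (pw S)) (0\<^sub>v (pw S)) (\<lambda>i. 0\<^sub>v (qv S i)) (\<lambda>i. 0\<^sub>v (qv S i))
      (\<lambda>k. 0\<^sub>v (pw S)) (\<lambda>k i. 0\<^sub>v (qv S i))) ` {0..k}) = 0" for k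
    by (intro Max_eqI) (auto simp: dnorm_zero intro!: image_eqI[of _ _ 0])
  then have bound: "vnorm (unit_err k) \<le> \<beta> (vnorm (unit_err 0)) k" for k
    using iss[rule_format, of "0\<^sub>v (pw S)" "0\<^sub>v (pw S)" "\<lambda>i. 0\<^sub>v (qv S i)" "\<lambda>i. 0\<^sub>v (qv S i)" "0\<^sub>v n"
        "vec n (\<lambda>_. - 1)" "vec n (\<lambda>_. 1)" "\<lambda>k. 0\<^sub>v (pw S)" "\<lambda>k i. 0\<^sub>v (qv S i)" k] \<open>\<gamma> 0 = 0\<close>
    by (simp add: vle_def)
  have "\<beta> (vnorm (unit_err 0)) \<longlonglongrightarrow> 0"
    using KL vnorm_nonneg by (simp add: class_KL_def)
  then have "(\<lambda>k. vnorm (unit_err k)) \<longlonglongrightarrow> 0"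
    by (rule tendsto_sandwich[OF _ _ tendsto_const, rotated 2]) (simp_all add: vnorm_nonneg bound)
  then show ?thesis by (rule unit_err_decay_imp_schur_stable)
qed

lemma schur_stable_imp_GES:
  assumes "H \<in> Hset S" "schur_stable (H * hatA S)"
  shows "GES_noise_free S"
proof -
  obtain C lam where C: "0 < C" "0 < lam" "lam < 1"
    and est: "\<And>wlo whi vlo vhi xlo0 xhi0 x0 w v k. dio_run S wlo whi vlo vhi xlo0 xhi0 x0 w v \<Longrightarrow>
      vnorm (err S wlo whi vlo vhi xlo0 xhi0 x0 w v k)
        \<le> C * lam ^ k * vnorm (err S wlo whi vlo vhi xlo0 xhi0 x0 w v 0)
          + C * dnorm S wlo whi vlo vhi w v 0"
    by (rule schur_stable_imp_estimate[OF assms]) (assumption | rule that)+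
  have run: "dio_run S (0\<^sub>v (pw S)) (0\<^sub>v (pw S)) (\<lambda>i. 0\<^sub>v (qv S i)) (\<lambda>i. 0\<^sub>v (qv S i))
      xlo0 xhi0 x0 (\<lambda>k. 0\<^sub>v (pw S)) (\<lambda>k i. 0\<^sub>v (qv S i))"
    if "dim_vec x0 = n" "vle xlo0 x0" "vle x0 xhi0" for xlo0 xhi0 x0
    using that by unfold_locales (auto simp: vle_def)
  show ?thesis
    unfolding GES_noise_free_def
  proof (intro exI conjI allI impI)
    show "0 < C" "0 < lam" "lam < 1" by fact+
  qed (use est[OF run] in \<open>simp add: dnorm_zero\<close>)
qed

lemma schur_stable_imp_ISS:
  assumes "H \<in> Hset S" "schur_stable (H * hatA S)"
  shows "ISS S"
proof -
  obtain C lam where C: "0 < C" "0 < lam" "lam < 1"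
    and est: "\<And>wlo whi vlo vhi xlo0 xhi0 x0 w v k. dio_run S wlo whi vlo vhi xlo0 xhi0 x0 w v \<Longrightarrow>
      vnorm (err S wlo whi vlo vhi xlo0 xhi0 x0 w v k)
        \<le> C * lam ^ k * vnorm (err S wlo whi vlo vhi xlo0 xhi0 x0 w v 0)
          + C * dnorm S wlo whi vlo vhi w v 0"
    by (rule schur_stable_imp_estimate[OF assms]) (assumption | rule that)+
  have lin: "class_K (\<lambda>r. a * r)" if "0 < a" for a :: real
    using that by (auto simp: class_K_def strict_mono_on_def intro!: continuous_intros)
  \<comment> \<open>Positivity of \<open>lam\<close> makes this linear function strictly increasing
    in \<open>r\<close> for every \<open>k\<close>.\<close>
  have "class_KL (\<lambda>r k. C * lam ^ k * r)"
    unfolding class_KL_def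
  proof (intro conjI allI impI)
    fix r :: real assume r: "0 \<le> r"
    show "antimono (\<lambda>k. C * lam ^ k * r)"
      using C r by (intro antimonoI mult_right_mono mult_left_mono power_decreasing) auto
    have "(\<lambda>k. C * lam ^ k * r) \<longlonglongrightarrow> C * 0 * r"
      using C by (intro tendsto_intros LIMSEQ_realpow_zero) auto
    then show "(\<lambda>k. C * lam ^ k * r) \<longlonglongrightarrow> 0" by simp
  qed (use C lin in auto)
  moreover have "class_Kinf (\<lambda>r. C * r)"
    unfolding class_Kinf_def
  proof (intro conjI allI)
    fix K :: real
    show "\<exists>r\<ge>0. K < C * r"
      using C by (intro exI[of _ "(\<bar>K\<bar> + 1) / C"]) auto
  qed (use C lin in auto)
  moreover have "vnorm (err S wlo whi vlo vhi xlo0 xhi0 x0 w v k)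
      \<le> C * lam ^ k * vnorm (err S wlo whi vlo vhi xlo0 xhi0 x0 w v 0)
        + C * Max (dnorm S wlo whi vlo vhi w v ` {0..k})"
    if "dim_vec wlo = pw S" "\<forall>i<N. dim_vec (vlo i) = qv S i \<and> vle (vlo i) (vhi i)"
      "dim_vec x0 = n" "vle xlo0 x0" "vle x0 xhi0" "\<forall>l. vle wlo (w l) \<and> vle (w l) whi"
      "\<forall>l. \<forall>i<N. vle (vlo i) (v l i) \<and> vle (v l i) (vhi i)"
    for wlo whi vlo vhi xlo0 xhi0 x0 w v k
  proof -
    have run: "dio_run S wlo whi vlo vhi xlo0 xhi0 x0 w v"
      using that by unfold_locales auto
    \<comment> \<open>The estimate involves the noise level at time 0 only, and 0 belongs to
      \<open>{0..k}\<close> for every \<open>k\<close>.\<close>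
    have "C * dnorm S wlo whi vlo vhi w v 0 \<le> C * Max (dnorm S wlo whi vlo vhi w v ` {0..k})"
      using C by (intro mult_left_mono Max_ge) auto
    then show ?thesis using est[OF run, of k] by linarith
  qed
  ultimately show ?thesis
    unfolding ISS_def by (intro exI[of _ "\<lambda>r k. C * lam ^ k * r"] exI[of _ "\<lambda>r. C * r"] conjI allI impI)
qed

end

theorem theorem1:
  assumes "wf_dsys S"
  shows "(GES_noise_free S \<longleftrightarrow> (\<exists>H\<in>Hset S. schur_stable (H * hatA S))) \<and>
         (ISS S \<longleftrightarrow> (\<exists>H\<in>Hset S. schur_stable (H * hatA S)))"
proof -
  interpret wf_system S by unfold_locales fact
  show ?thesis
    by (auto intro: GES_imp_schur_stable ISS_imp_schur_stable elim: schur_stable_imp_GES schur_stable_imp_ISS)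
qed

end
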